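(* For $r>0$ let $f_r:(0,\infty)\to\mathbb{R}$ be defined by $$f_r(x)=\frac{\log(1+rx)}{\log(1+x)},\quad x>0.$$ Then $f_r$ is a complete Bernstein function when $0<r<1$, and $f_r$ is a Stieltjes function when $r>1$.
   Context: A function $m:(0,\infty)\to[0,\infty)$ is completely monotonic if it is $C^\infty$ and $(-1)^n m^{(n)}(s)\ge 0$ for all $s>0$, $n=0,1,2,\ldots$. A Bernstein function is a $C^\infty$-function $f:(0,\infty)\to[0,\infty)$ with $(-1)^{n-1}f^{(n)}(x)\ge 0$ for all $x>0$, $n=1,2,\ldots$. A complete Bernstein function is a function $f:(0,\infty)\to[0,\infty)$ of the form $$f(x)=a+bx+\int_0^\infty (1-e^{-xs})\,m(s)\,ds,\quad x>0,$$ where $a,b\ge 0$ and $m:(0,\infty)\to[0,\infty)$ is completely monotonic with $\int_0^\infty \min(1,s)\,m(s)\,ds<\infty$. (Every complete Bernstein function is a Bernstein function.) A Stieltjes function is a function $f:(0,\infty)\to[0,\infty)$ of the form $$f(x)=c+\int_{[0,\infty)}\frac{d\mu(t)}{x+t},\quad x>0,$$ where $c\ge 0$ and $\mu$ is a positive measure on $[0,\infty)$ such that the integral converges for every $x>0$. *)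

theory Defs
  imports "HOL-Analysis.Analysis"
begin

text \<open>
  A function on the open half-line \<open>(0, \<infinity>)\<close> is represented by a total function
  \<^typ>\<open>real \<Rightarrow> real\<close>. The definitions below refer only to its values at positive arguments:
  since \<open>(0, \<infinity>)\<close> is open, an iterated derivative at \<open>x > 0\<close> depends only on values near \<open>x\<close>.
\<close>

definition smooth_on_pos :: "(real \<Rightarrow> real) \<Rightarrow> bool" where
  "smooth_on_pos f \<longleftrightarrow> (\<forall>n. \<forall>x>0. (deriv ^^ n) f field_differentiable (at x))"

definition completely_monotonic :: "(real \<Rightarrow> real) \<Rightarrow> bool" where
  "completely_monotonic m \<longleftrightarrow>
     (\<forall>s>0. 0 \<le> m s) \<and> smooth_on_pos m \<and> (\<forall>n. \<forall>s>0. 0 \<le> (-1) ^ n * (deriv ^^ n) m s)"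

text \<open>
  Integrability of \<open>min 1 s * m s\<close> implies that of \<open>(1 - exp (- x * s)) * m s\<close> for every
  \<open>x > 0\<close>, so the Bochner integral below is never the default value 0 of a divergent integral.
\<close>

definition complete_Bernstein_function :: "(real \<Rightarrow> real) \<Rightarrow> bool" where
  "complete_Bernstein_function f \<longleftrightarrow>
     (\<forall>x>0. 0 \<le> f x) \<and>
     (\<exists>a b m. 0 \<le> a \<and> 0 \<le> b \<and> completely_monotonic m \<and>
        set_integrable lborel {0<..} (\<lambda>s. min 1 s * m s) \<and>
        (\<forall>x>0. f x = a + b * x + (LBINT s:{0<..}. (1 - exp (- x * s)) * m s)))"

definition Stieltjes_function :: "(real \<Rightarrow> real) \<Rightarrow> bool" where
  "Stieltjes_function f \<longleftrightarrow>
     (\<forall>x>0. 0 \<le> f x) \<and>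
     (\<exists>c \<mu>. 0 \<le> c \<and> sets \<mu> = sets (restrict_space borel {0..}) \<and>
        (\<forall>x>0. integrable \<mu> (\<lambda>t. 1 / (x + t))) \<and>
        (\<forall>x>0. f x = c + (\<integral>t. 1 / (x + t) \<partial>\<mu>)))"

definition log_quotient :: "real \<Rightarrow> real \<Rightarrow> real" where
  "log_quotient r x = ln (1 + r * x) / ln (1 + x)"

end

theory Submission
  imports Defs "HOL-Complex_Analysis.Complex_Analysis" "HOL-Real_Asymp.Real_Asymp"
begin

text \<open>
  For \<open>0 < q < 1\<close> let \<open>G(z) = Ln (1 - q + q e\<^sup>z) / z\<close>, which is holomorphic and free of zeros
  in the strip \<open>\<bar>Im z\<bar> < pi\<close>. Then \<open>f\<^sub>r(x) = G(ln (1 + x))\<close> with \<open>q = r\<close> if \<open>r < 1\<close>, and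
  \<open>f\<^sub>r(x) = 1 / G(ln (1 + r x))\<close> with \<open>q = 1 / r\<close> if \<open>r > 1\<close>. For \<open>H = G\<close> and for \<open>H = 1 / G\<close>,
  integrating \<open>H(z) e\<^sup>z / (e\<^sup>z - y)\<close> around a rectangle that exhausts the strip yields
  \<open>H(ln y) = 1 - (1 / pi) \<integral> Im H(u + i pi) e\<^sup>u / (e\<^sup>u + y) du\<close> for all \<open>y > 0\<close>, where \<open>1\<close> is the limit
  of \<open>H\<close> at the right end. On the boundary, \<open>Im G \<ge> 0\<close> and hence \<open>Im (1 / G) \<le> 0\<close>. So the formula for
  \<open>1 / G\<close> is a Stieltjes representation, and the one for \<open>G\<close>, normalised at \<open>y = 1\<close> (that is \<open>x = 0\<close>, where
  \<open>G(0) = q\<close>), becomes a complete Bernstein representation because \<open>1 / t\<close> is the Laplace transform of \<open>1\<close>.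
\<close>

subsection \<open>Boundary representation on a strip\<close>

lemma has_contour_integral_linepath_same_Im_iff:
  assumes "Im z = c" "Im z' = c" "Re z = a" "Re z' = b" "a < b"
  shows   "(f has_contour_integral I) (linepath z z') \<longleftrightarrow>
             ((\<lambda>x. f (Complex x c)) has_integral I) {a..b}"
proof -
  have "(f has_contour_integral I) (linepath z z') \<longleftrightarrow>
          ((\<lambda>x. f (linepath z z' x) * (z' - z)) has_integral I) {0..1}"
    by (subst has_contour_integral_linepath) simp_all
  also have "(\<lambda>x. f (linepath z z' x) * (z' - z)) = (\<lambda>x. (b - a) *\<^sub>R f (Complex ((b - a) * x + a) c))"
  proof
    fix x
    have "linepath z z' x = Complex ((b - a) * x + a) c" "z' - z = of_real (b - a)"
      using assms by (auto simp: linepath_def complex_eq_iff algebra_simps)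
    thus "f (linepath z z' x) * (z' - z) = (b - a) *\<^sub>R f (Complex ((b - a) * x + a) c)"
      by (simp only: scaleR_conv_of_real mult.commute)
  qed
  also have "(\<dots> has_integral I) {0..1} \<longleftrightarrow> ((\<lambda>x. f (Complex ((b - a) * x + a) c)) has_integral (I /\<^sub>R (b - a))) {0..1}"
    using has_integral_cmul_iff[of "b - a" "\<lambda>x. f (Complex ((b - a) * x + a) c)" "I /\<^sub>R (b - a)" "{0..1}"] assms
    by simp
  also have "\<dots> \<longleftrightarrow> ((\<lambda>x. f (Complex x c)) has_integral I) {a..b}"
    using has_integral_affinity_iff[of "b - a" "\<lambda>x. f (Complex x c)" a I a b] assms by simp
  finally show ?thesis .
qed

text \<open>Only the boundary of the rectangle has to lie in \<open>S\<close>, so \<open>F\<close>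
  may have a pole inside. The vertical edges carry the factor i from dz = i dv; the top and left
  edges are traversed backwards.\<close>

lemma contour_integral_rectpath_split:
  assumes "F holomorphic_on S" "open S"
    and S: "\<And>z. \<bar>Re z\<bar> \<le> R \<Longrightarrow> \<bar>Im z\<bar> \<le> h \<Longrightarrow> \<bar>Re z\<bar> = R \<or> \<bar>Im z\<bar> = h \<Longrightarrow> z \<in> S"
    and "0 < R" "0 < h"
  shows "contour_integral (rectpath (Complex (-R) (-h)) (Complex R h)) F =
    integral {-R..R} (\<lambda>u. F (Complex u (-h))) - integral {-R..R} (\<lambda>u. F (Complex u h))
    + \<i> * (integral {-h..h} (\<lambda>v. F (Complex R v)) - integral {-h..h} (\<lambda>v. F (Complex (-R) v)))"
proof -
  have seg: "closed_segment (Complex a b) (Complex c d) \<subseteq> S"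
    if "(a = c \<and> \<bar>a\<bar> = R \<and> \<bar>b\<bar> = h \<and> \<bar>d\<bar> = h) \<or> (b = d \<and> \<bar>b\<bar> = h \<and> \<bar>a\<bar> = R \<and> \<bar>c\<bar> = R)" for a b c d
  proof
    fix z assume z: "z \<in> closed_segment (Complex a b) (Complex c d)"
    have seg: "closed_segment b d \<subseteq> {-h..h}" "closed_segment a c \<subseteq> {-R..R}"
      using that assms(4,5) by (auto simp: closed_segment_eq_real_ivl)
    from that consider "a = c" "\<bar>a\<bar> = R" | "b = d" "\<bar>b\<bar> = h" by blast
    hence "\<bar>Re z\<bar> \<le> R \<and> \<bar>Im z\<bar> \<le> h \<and> (\<bar>Re z\<bar> = R \<or> \<bar>Im z\<bar> = h)"
    proof cases
      case 1
      hence "Re z = a" "Im z \<in> closed_segment b d"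
        using z closed_segment_same_Re[of "Complex a b" "Complex c d"] by auto
      with seg(1) have "Im z \<in> {-h..h}" by blast
      with \<open>Re z = a\<close> 1 show ?thesis by auto
    next
      case 2
      hence "Im z = b" "Re z \<in> closed_segment a c"
        using z closed_segment_same_Im[of "Complex a b" "Complex c d"] by auto
      with seg(2) have "Re z \<in> {-R..R}" by blast
      with \<open>Im z = b\<close> 2 show ?thesis by auto
    qed
    thus "z \<in> S" using S by blast
  qed
  have ci: "F contour_integrable_on linepath (Complex a b) (Complex c d)"
    if "(a = c \<and> \<bar>a\<bar> = R \<and> \<bar>b\<bar> = h \<and> \<bar>d\<bar> = h) \<or> (b = d \<and> \<bar>b\<bar> = h \<and> \<bar>a\<bar> = R \<and> \<bar>c\<bar> = R)" for a b c d
    using seg[OF that] assms(1,2)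
    by (intro contour_integrable_continuous_linepath continuous_on_subset[OF holomorphic_on_imp_continuous_on])
  have hor: "contour_integral (linepath (Complex (-R) v) (Complex R v)) F = integral {-R..R} (\<lambda>u. F (Complex u v))"
    if "\<bar>v\<bar> = h" for v
  proof -
    from ci[of "-R" R v v] that assms have "F contour_integrable_on linepath (Complex (-R) v) (Complex R v)" by auto
    from has_contour_integral_integral[OF this]
    show ?thesis using assms
      by (subst (asm) has_contour_integral_linepath_same_Im_iff[where a = "-R" and b = R and c = v]) (auto dest!: integral_unique)
  qed
  have ver: "contour_integral (linepath (Complex u (-h)) (Complex u h)) F = \<i> * integral {-h..h} (\<lambda>v. F (Complex u v))"
    if "\<bar>u\<bar> = R" for u
  proof -
    from ci[of u u "-h" h] that assms have "F contour_integrable_on linepath (Complex u (-h)) (Complex u h)" by auto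
    from has_contour_integral_integral[OF this]
    show ?thesis using assms
      by (subst (asm) has_contour_integral_linepath_same_Re_iff[where a = "-h" and b = h and c = u]) (auto dest!: integral_unique)
  qed
  have rev: "contour_integral (linepath (Complex R h) (Complex (-R) h)) F = - integral {-R..R} (\<lambda>u. F (Complex u h))"
    "contour_integral (linepath (Complex (-R) h) (Complex (-R) (-h))) F = - (\<i> * integral {-h..h} (\<lambda>v. F (Complex (-R) v)))"
    using hor[of h] ver[of "-R"] assms
      contour_integral_reversepath[of "linepath (Complex (-R) h) (Complex R h)" F]
      contour_integral_reversepath[of "linepath (Complex (-R) (-h)) (Complex (-R) h)" F] by simp_all
  show ?thesis
    unfolding rectpath_def Let_def using assms
    by (simp add: ci contour_integrable_join valid_path_join hor ver rev algebra_simps)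
qed

lemma open_strip: "open {z. \<bar>Im z\<bar> < pi}"
proof -
  have "{z. \<bar>Im z\<bar> < pi} = {z. Im z < pi} \<inter> {z. Im z > - pi}" by auto
  thus ?thesis by (simp add: open_halfspace_Im_lt open_halfspace_Im_gt open_Int)
qed

text \<open>Residue theorem: within the strip \<open>F\<close> can be singular only at
  \<open>ln y\<close>, with residue \<open>H (of_real (ln y))\<close>. By the reflection symmetry
  the lower edge is the conjugate of the upper one, so together they leave only an imaginary
  part.\<close>

lemma holomorphic_strip_rectangle:
  fixes H :: "complex \<Rightarrow> complex"
  assumes hol: "H holomorphic_on {z. \<bar>Im z\<bar> < pi}"
    and cnj: "\<And>z. \<bar>Im z\<bar> < pi \<Longrightarrow> H (cnj z) = cnj (H z)"
    and y: "0 < y" "\<bar>ln y\<bar> < R" and h: "0 < h" "h < pi"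
  defines "F \<equiv> \<lambda>z. H z * exp z / (exp z - of_real y)"
  shows "of_real (- 2 * Im (integral {-R..R} (\<lambda>u. F (Complex u h))))
     + integral {-h..h} (\<lambda>v. F (Complex R v)) - integral {-h..h} (\<lambda>v. F (Complex (-R) v))
     = of_real (2 * pi) * H (of_real (ln y))"
proof -
  let ?S = "{z. \<bar>Im z\<bar> < pi}"
  let ?z = "complex_of_real (ln y)"
  have "?S = {z. Im z < pi} \<inter> {z. Im z > - pi}" by auto
  hence "convex ?S"
    by (simp only: convex_halfspace_Im_lt convex_halfspace_Im_gt convex_Int)
  note S = open_strip this
  have expz: "exp ?z = of_real y"
    by (subst exp_of_real) (use y in simp)
  have eq0: "exp z = of_real y \<longleftrightarrow> z = ?z" if "z \<in> ?S" for z
  proof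
    assume "exp z = of_real y"
    hence "exp z = exp ?z" using expz by simp
    moreover have "\<bar>Im z - Im ?z\<bar> < 2 * pi" using that by simp
    ultimately show "z = ?z" using exp_complex_eqI by blast
  next
    assume "z = ?z"
    thus "exp z = of_real y" by (simp only: expz)
  qed
  have holF: "F holomorphic_on ?S - {?z}"
    unfolding F_def using eq0 by (intro holomorphic_intros holomorphic_on_subset[OF hol]) auto
  have res: "residue F ?z = H ?z"
  proof -
    have "isCont H ?z"
      using hol S(1) holomorphic_on_imp_continuous_on continuous_on_interior[of ?S H ?z] by (simp add: interior_open)
    \<comment> \<open>The difference quotient of \<open>exp\<close> tends to its derivative, which
      cancels the factor \<open>exp w\<close> of the numerator and leaves \<open>H\<close> alone as
      residue.\<close>
    moreover have "((\<lambda>w. (exp w - exp ?z) / (w - ?z)) \<longlongrightarrow> exp ?z) (at ?z)"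
      using DERIV_exp[of ?z] by (simp only: has_field_derivative_iff)
    ultimately have "((\<lambda>w. H w * exp w / ((exp w - exp ?z) / (w - ?z))) \<longlongrightarrow> H ?z * exp ?z / exp ?z) (at ?z)"
      by (intro tendsto_intros) (auto simp: isCont_def)
    hence "((\<lambda>w. F w * (w - ?z)) \<longlongrightarrow> H ?z) (at ?z)"
      unfolding F_def expz using y(1) by (simp add: field_simps)
    thus ?thesis
      using holF S(1) by (intro residue_simple') auto
  qed
  let ?g = "rectpath (Complex (-R) (-h)) (Complex R h)"
  have R: "0 < R" using y by linarith
  have zbox: "?z \<in> box (Complex (-R) (-h)) (Complex R h)"
    using y h by (auto simp: in_box_complex_iff)
  have pim: "path_image ?g \<subseteq> ?S - {?z}"
    using R h y by (subst path_image_rectpath) auto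
  have "contour_integral ?g F = 2 * pi * \<i> * (\<Sum>p\<in>{?z}. winding_number ?g p * residue F p)"
  proof (rule Residue_theorem)
    show "\<forall>z. z \<notin> ?S \<longrightarrow> winding_number ?g z = 0"
      using R h by (auto intro!: winding_number_rectpath_outside simp: in_cbox_complex_iff)
  qed (use S holF pim in \<open>auto intro: convex_connected\<close>)
  also have "\<dots> = 2 * pi * \<i> * H ?z"
    using zbox res by (simp add: winding_number_rectpath)
  also have "contour_integral ?g F =
    integral {-R..R} (\<lambda>u. F (Complex u (-h))) - integral {-R..R} (\<lambda>u. F (Complex u h))
    + \<i> * (integral {-h..h} (\<lambda>v. F (Complex R v)) - integral {-h..h} (\<lambda>v. F (Complex (-R) v)))"
  proof (rule contour_integral_rectpath_split[OF holF])
    show "open (?S - {?z})" using S by auto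
  qed (use R h y in \<open>auto simp: complex_eq_iff\<close>)
  also have "integral {-R..R} (\<lambda>u. F (Complex u (-h))) = cnj (integral {-R..R} (\<lambda>u. F (Complex u h)))"
  proof -
    have "F (Complex u (-h)) = cnj (F (Complex u h))" for u
      using cnj[of "Complex u h"] h by (simp add: F_def exp_cnj complex_cnj)
    thus ?thesis by (simp add: integral_cnj)
  qed
  also have "\<dots> - integral {-R..R} (\<lambda>u. F (Complex u h)) = \<i> * of_real (- 2 * Im (integral {-R..R} (\<lambda>u. F (Complex u h))))"
    by (simp add: complex_eq_iff)
  finally have "\<i> * (of_real (- 2 * Im (integral {-R..R} (\<lambda>u. F (Complex u h))))
     + integral {-h..h} (\<lambda>v. F (Complex R v)) - integral {-h..h} (\<lambda>v. F (Complex (-R) v))) = \<i> * (of_real (2 * pi) * H ?z)"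
    by (simp add: algebra_simps)
  thus ?thesis by (subst (asm) mult_cancel_left) auto
qed

text \<open>The upper edge is moved to \<open>Im z = pi\<close> by dominated convergence. There
  \<open>exp z\<close> is negative, so the kernel becomes the real number
  \<open>exp u / (exp u + y)\<close> and only \<open>Im H\<close> survives. The right edge
  contributes about \<open>2 * pi\<close> and the left edge almost nothing; the exceptional point
  \<open>c\<close> is a null set.\<close>

lemma boundary_integral_estimate:
  fixes H :: "complex \<Rightarrow> complex"
  assumes hol: "H holomorphic_on {z. \<bar>Im z\<bar> < pi}"
    and cnj: "\<And>z. \<bar>Im z\<bar> < pi \<Longrightarrow> H (cnj z) = cnj (H z)"
    and B: "B integrable_on {-R..R}"
    and dom: "\<And>u v. \<bar>u\<bar> \<le> R \<Longrightarrow> u \<noteq> c \<Longrightarrow> pi / 2 \<le> v \<Longrightarrow> v < pi \<Longrightarrow> norm (H (Complex u v)) \<le> B u"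
    and bdry: "\<And>u. u \<noteq> c \<Longrightarrow> ((\<lambda>v. H (Complex u v)) \<longlongrightarrow> H (Complex u pi)) (at_left pi)"
    and y: "0 < y" "\<bar>ln y\<bar> < R"
  defines "F \<equiv> \<lambda>z. H z * exp z / (exp z - of_real y)"
  assumes right: "\<And>v. \<bar>v\<bar> < pi \<Longrightarrow> norm (F (Complex R v) - 1) \<le> e"
    and left: "\<And>v. \<bar>v\<bar> < pi \<Longrightarrow> norm (F (Complex (-R) v)) \<le> e"
  shows "(\<lambda>u. Im (H (Complex u pi)) * (exp u / (exp u + y))) integrable_on {-R..R}" (is ?int)
    and "\<bar>integral {-R..R} (\<lambda>u. Im (H (Complex u pi)) * (exp u / (exp u + y)))
            - pi * (1 - Re (H (of_real (ln y))))\<bar> \<le> 2 * pi * e" (is ?bd)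
proof -
  let ?S = "{z. \<bar>Im z\<bar> < pi}"
  let ?z = "complex_of_real (ln y)"
  have R: "0 < R" using y by linarith
  have e: "0 \<le> e" using order_trans[OF norm_ge_zero left[of 0]] by simp
  \<comment> \<open>The pole is avoided for two reasons: in the upper range of \<open>v\<close> the
    real part of \<open>exp z\<close> is not positive, and on the vertical edges
    \<open>norm (exp z)\<close> differs from \<open>y\<close>.\<close>
  have expne: "exp (Complex u v) \<noteq> of_real y" if "pi / 2 \<le> v \<and> v \<le> pi \<or> \<bar>v\<bar> < pi \<and> \<bar>u\<bar> = R" for u v
  proof
    assume eq: "exp (Complex u v) = of_real y"
    from that show False
    proof
      assume v: "pi / 2 \<le> v \<and> v \<le> pi"
      have "cos v \<le> 0" using v cos_monotone_0_pi_le[of "pi/2" v] by simp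
      moreover have "exp u * cos v = y" using arg_cong[OF eq, of Re] by (simp add: Re_exp)
      ultimately show False using y(1) by (smt (verit) exp_gt_zero mult_nonneg_nonpos)
    next
      assume v: "\<bar>v\<bar> < pi \<and> \<bar>u\<bar> = R"
      have "exp u = y" using arg_cong[OF eq, of norm] y(1) by simp
      thus False using y v by auto
    qed
  qed
  have contF: "continuous_on {z\<in>?S. exp z \<noteq> of_real y} F"
    unfolding F_def using holomorphic_on_imp_continuous_on[OF hol]
    by (intro continuous_intros continuous_on_subset[OF holomorphic_on_imp_continuous_on[OF hol]]) auto
  have ContC: "continuous_on A (\<lambda>u. Complex u v)" "continuous_on A (Complex u)" for A u v
    unfolding Complex_eq by (intro continuous_intros)+
  have contv: "continuous_on {-h..h} (\<lambda>v. F (Complex u v))" if "h < pi" "\<bar>u\<bar> = R" for u h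
  proof (rule continuous_on_compose2[OF contF ContC(2)], rule image_subsetI)
    fix v assume "v \<in> {-h..h}"
    with that have "\<bar>v\<bar> < pi" by auto
    with that expne[of v u] show "Complex u v \<in> {z \<in> ?S. exp z \<noteq> of_real y}" by simp
  qed
  have conth: "continuous_on {-R..R} (\<lambda>u. F (Complex u v))" if "pi/2 \<le> v" "v < pi" for v
    using that expne[of v] by (intro continuous_on_compose2[OF contF ContC(1)]) auto

  \<comment> \<open>Since \<open>pi\<close> is at least 2, these heights never drop below
    \<open>pi / 2\<close>, so their cosine is not positive; the kernel bound rests on this.\<close>
  define h where "h n = pi - 1 / real (Suc n)" for n
  have h: "pi / 2 \<le> h n" "h n < pi" for n
  proof -
    have "1 / real (Suc n) \<le> 1" by simp
    thus "pi / 2 \<le> h n" unfolding h_def using pi_ge_two by linarith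
    show "h n < pi" by (simp add: h_def)
  qed
  have hlim: "h \<longlonglongrightarrow> pi"
    unfolding h_def using LIMSEQ_inverse_real_of_nat_add_minus[of pi] by (simp add: inverse_eq_divide)
  have hleft: "filterlim h (at_left pi) sequentially"
    unfolding filterlim_at using hlim h(2) by (auto intro!: always_eventually simp: less_imp_neq)
  let ?A = "\<lambda>v. integral {-R..R} (\<lambda>u. F (Complex u v))"
  \<comment> \<open>Real part of the rectangle identity. Each vertical edge is off by at most
    \<open>2 * pi * e\<close>; the identity contains \<open>2 * Im\<close>, so halving it leaves
    \<open>2 * pi * e\<close> in total.\<close>
  have key: "\<bar>Im (?A (h n)) - (h n - pi * Re (H ?z))\<bar> \<le> 2 * pi * e" for n
  proof -
    let ?h = "h n"
    let ?IR = "integral {- ?h.. ?h} (\<lambda>v. F (Complex R v))"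
    let ?IL = "integral {- ?h.. ?h} (\<lambda>v. F (Complex (-R) v))"
    have hp: "0 < ?h" using h(1)[of n] pi_gt_zero by linarith
    have b: "\<bar>v\<bar> < pi" if "v \<in> cbox (- ?h) ?h" for v using that h(2)[of n] by auto
    have "of_real (- 2 * Im (?A ?h)) + ?IR - ?IL = of_real (2 * pi) * H ?z"
      using holomorphic_strip_rectangle[OF hol cnj y hp h(2)] unfolding F_def by blast
    from arg_cong[OF this, of Re] have "- 2 * Im (?A ?h) + Re ?IR - Re ?IL = 2 * pi * Re (H ?z)" by simp
    moreover have "norm (?IR - of_real (2 * ?h)) \<le> e * (2 * ?h)"
    proof -
      have "((\<lambda>v. F (Complex R v) - 1) has_integral (?IR - of_real (2 * ?h))) (cbox (- ?h) ?h)"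
        using has_integral_diff[OF integrable_integral[OF integrable_continuous_real[OF contv[of ?h R]]]
            has_integral_const_real[of "1::complex" "- ?h" ?h]] h(2)[of n] hp R by (simp add: scaleR_conv_of_real)
      from has_integral_bound[OF e this right[OF b]] show ?thesis using hp by simp
    qed
    moreover have "norm ?IL \<le> e * (2 * ?h)"
    proof -
      have "((\<lambda>v. F (Complex (-R) v)) has_integral ?IL) (cbox (- ?h) ?h)"
        using integrable_integral[OF integrable_continuous_real[OF contv[of ?h "-R"]]] h(2)[of n] hp R by simp
      from has_integral_bound[OF e this left[OF b]] show ?thesis using hp by simp
    qed
    moreover have "\<bar>Re ?IR - 2 * ?h\<bar> \<le> norm (?IR - of_real (2 * ?h))" "\<bar>Re ?IL\<bar> \<le> norm ?IL"
      using abs_Re_le_cmod[of "?IR - of_real (2 * ?h)"] abs_Re_le_cmod[of ?IL] by simp_all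
    moreover have "e * (2 * ?h) \<le> 2 * pi * e" using e h(2)[of n] by (simp add: mult_left_mono mult.commute)
    ultimately show ?thesis by linarith
  qed

  let ?D = "{-R..R} - {c}"
  let ?K = "\<lambda>u v. exp (Complex u v) / (exp (Complex u v) - of_real y)"
  let ?g = "\<lambda>u. F (Complex u pi)"
  have intD: "f integrable_on ?D \<longleftrightarrow> f integrable_on {-R..R}" "integral ?D f = integral {-R..R} f"
    for f :: "real \<Rightarrow> 'b::euclidean_space"
    by (rule integrable_spike_set_eq integral_spike_set; rule negligible_subset[of "{c}"]; auto)+
  have le: "norm (F (Complex u (h n))) \<le> B u" if u: "u \<in> ?D" for n u
  proof -
    \<comment> \<open>Because \<open>cos (h n)\<close> is not positive, subtracting
      \<open>y > 0\<close> from the exponential cannot decrease its norm.\<close>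
    have "norm (?K u (h n)) \<le> 1"
    proof -
      have cs: "cos (h n) \<le> 0" using h[of n] cos_monotone_0_pi_le[of "pi/2" "h n"] by simp
      have "(norm (exp (Complex u (h n))))\<^sup>2 \<le> (norm (exp (Complex u (h n)) - of_real y))\<^sup>2"
      proof -
        have "2 * (exp u * cos (h n)) * y \<le> 0" using cs y(1) by (simp add: mult_nonneg_nonpos mult_nonpos_nonneg)
        also have "0 \<le> y\<^sup>2" by simp
        finally show ?thesis unfolding cmod_power2 by (simp add: Re_exp Im_exp power2_diff)
      qed
      hence "norm (exp (Complex u (h n))) \<le> norm (exp (Complex u (h n)) - of_real y)"
        by (rule power2_le_imp_le) simp
      thus ?thesis using expne[of "h n" u] h[of n] by (simp add: norm_divide del: norm_exp_eq_Re)
    qed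
    moreover have nH: "norm (H (Complex u (h n))) \<le> B u" using u h[of n] by (intro dom) auto
    moreover have "0 \<le> B u" using order_trans[OF norm_ge_zero nH] .
    ultimately have "norm (H (Complex u (h n))) * norm (?K u (h n)) \<le> B u * 1"
      by (intro mult_mono) auto
    thus ?thesis by (simp add: F_def norm_mult norm_divide)
  qed
  have conv: "(\<lambda>n. F (Complex u (h n))) \<longlonglongrightarrow> ?g u" if u: "u \<in> ?D" for u
  proof -
    have 1: "(\<lambda>n. H (Complex u (h n))) \<longlonglongrightarrow> H (Complex u pi)"
      using u by (intro filterlim_compose[OF bdry hleft]) auto
    have 2: "(\<lambda>n. exp (Complex u (h n))) \<longlonglongrightarrow> exp (Complex u pi)"
      using hlim by (intro tendsto_intros)
    show ?thesis
      unfolding F_def using expne[of pi u] by (intro tendsto_intros 1 2) auto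
  qed
  have fint: "(\<lambda>u. F (Complex u (h n))) integrable_on ?D" for n
    unfolding intD using h by (intro integrable_continuous_real conth)
  have Bint: "B integrable_on ?D" using B by (simp only: intD)
  note dc = dominated_convergence[OF fint Bint le conv]
  have Img: "Im (?g u) = Im (H (Complex u pi)) * (exp u / (exp u + y))" for u
  proof -
    have "exp (Complex u pi) = of_real (- exp u)" by (simp add: complex_eq_iff Re_exp Im_exp)
    hence "exp (Complex u pi) / (exp (Complex u pi) - of_real y) = of_real (- exp u / (- exp u - y))"
      by (simp only: of_real_diff of_real_divide)
    also have "- exp u / (- exp u - y) = exp u / (exp u + y)"
      by (metis (no_types, opaque_lifting) minus_add_distrib minus_divide_divide uminus_add_conv_diff add.commute)
    finally have "?g u = H (Complex u pi) * of_real (exp u / (exp u + y))"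
      unfolding F_def by (metis times_divide_eq_right)
    thus ?thesis by simp
  qed
  have gint: "?g integrable_on {-R..R}" using dc(1) by (simp add: intD)
  show ?int using integrable_linear[OF gint bounded_linear_Im] by (simp add: o_def Img)
  have eq: "Im (integral {-R..R} ?g) = integral {-R..R} (\<lambda>u. Im (H (Complex u pi)) * (exp u / (exp u + y)))"
    using integral_linear[OF gint bounded_linear_Im] by (simp add: o_def Img)
  have "(\<lambda>n. \<bar>Im (?A (h n)) - (h n - pi * Re (H ?z))\<bar>) \<longlonglongrightarrow> \<bar>Im (integral {-R..R} ?g) - (pi - pi * Re (H ?z))\<bar>"
    using dc(2) hlim by (intro tendsto_intros) (simp_all add: intD)
  from LIMSEQ_le_const2[OF this] key have "\<bar>Im (integral {-R..R} ?g) - (pi - pi * Re (H ?z))\<bar> \<le> 2 * pi * e" by blast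
  thus ?bd by (simp add: eq algebra_simps)
qed

text \<open>The boundary function is a pointwise limit of functions continuous in \<open>u\<close>.
  Convergence at \<open>c\<close> is not assumed, so the approximants already receive the final
  value there.\<close>

lemma strip_boundary_measurable:
  fixes H :: "complex \<Rightarrow> complex"
  assumes hol: "H holomorphic_on {z. \<bar>Im z\<bar> < pi}"
    and bdry: "\<And>u. u \<noteq> c \<Longrightarrow> ((\<lambda>v. H (Complex u v)) \<longlongrightarrow> H (Complex u pi)) (at_left pi)"
  shows "(\<lambda>u. H (Complex u pi)) \<in> borel_measurable borel"
proof (rule borel_measurable_LIMSEQ_metric)
  define h where "h n = pi - 1 / real (Suc n)" for n
  have h: "\<bar>h n\<bar> < pi" for n
  proof -
    have "1 / real (Suc n) \<le> 1" by simp
    moreover have "0 < 1 / real (Suc n)" by simp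
    ultimately show ?thesis unfolding h_def using pi_ge_two by linarith
  qed
  have "h \<longlonglongrightarrow> pi"
    unfolding h_def using LIMSEQ_inverse_real_of_nat_add_minus[of pi] by (simp add: inverse_eq_divide)
  hence hleft: "filterlim h (at_left pi) sequentially"
    unfolding filterlim_at using h by (auto intro!: always_eventually simp: abs_less_iff less_imp_neq)
  let ?f = "\<lambda>n u. if u = c then H (Complex c pi) else H (Complex u (h n))"
  show "?f n \<in> borel_measurable borel" for n
  proof -
    have "continuous_on UNIV (\<lambda>u. Complex u (h n))"
      unfolding Complex_eq by (intro continuous_intros)
    hence "continuous_on UNIV (\<lambda>u. H (Complex u (h n)))"
      by (rule continuous_on_compose2[OF holomorphic_on_imp_continuous_on[OF hol]]) (use h[of n] in auto)
    hence [measurable]: "(\<lambda>u. H (Complex u (h n))) \<in> borel_measurable borel"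
      by (rule borel_measurable_continuous_onI)
    show ?thesis by measurable
  qed
  show "(\<lambda>n. ?f n u) \<longlonglongrightarrow> H (Complex u pi)" for u
    using filterlim_compose[OF bdry[of u] hleft] by (cases "u = c") auto
qed

text \<open>The rectangle is widened. Convergence of the integrals over \<open>{-R..R}\<close> alone
  would not give Bochner integrability; the constant sign in \<open>sgn\<close> does, through
  monotone convergence. The factor \<open>s\<close> lets one statement cover both signs of
  \<open>Im H\<close>.\<close>

lemma strip_representation:
  fixes H :: "complex \<Rightarrow> complex"
  assumes hol: "H holomorphic_on {z. \<bar>Im z\<bar> < pi}"
    and cnj: "\<And>z. \<bar>Im z\<bar> < pi \<Longrightarrow> H (cnj z) = cnj (H z)"
    and B: "\<And>R. B R integrable_on {-R..R}"
    and dom: "\<And>R u v. \<bar>u\<bar> \<le> R \<Longrightarrow> u \<noteq> c \<Longrightarrow> pi / 2 \<le> v \<Longrightarrow> v < pi \<Longrightarrow> norm (H (Complex u v)) \<le> B R u"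
    and bdry: "\<And>u. u \<noteq> c \<Longrightarrow> ((\<lambda>v. H (Complex u v)) \<longlongrightarrow> H (Complex u pi)) (at_left pi)"
    and right: "\<And>e. 0 < e \<Longrightarrow> \<forall>\<^sub>F R in at_top. \<forall>v. \<bar>v\<bar> < pi \<longrightarrow> norm (H (Complex R v) - 1) \<le> e"
    and left: "\<And>e. 0 < e \<Longrightarrow> \<forall>\<^sub>F R in at_top. \<forall>v. \<bar>v\<bar> < pi \<longrightarrow> norm (H (Complex (-R) v)) * exp (-R) \<le> e"
    and sgn: "\<And>u. 0 \<le> s * Im (H (Complex u pi))"
    and y: "0 < y"
  shows "has_bochner_integral lborel (\<lambda>u. s * Im (H (Complex u pi)) * (exp u / (exp u + y)))
           (s * (pi * (1 - Re (H (of_real (ln y))))))"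
proof -
  let ?F = "\<lambda>z. H z * exp z / (exp z - of_real y)"
  let ?phi = "\<lambda>u. Im (H (Complex u pi)) * (exp u / (exp u + y))"
  let ?L = "pi * (1 - Re (H (of_real (ln y))))"
  have rightF: "\<forall>\<^sub>F R in at_top. \<forall>v. \<bar>v\<bar> < pi \<longrightarrow> norm (?F (Complex R v) - 1) \<le> e" if e: "0 < e" for e
  proof -
    \<comment> \<open>With the kernel \<open>K\<close> the error splits as
      \<open>(H ?z - 1) * K + (K - 1)\<close>; since \<open>norm K\<close> is at most 2, it is at
      most \<open>3 * d\<close>, which is below \<open>e\<close>.\<close>
    define d where "d = min 1 (e / 4)"
    have d: "0 < d" "d \<le> 1" "d \<le> e / 4" using e by (auto simp: d_def)
    have "((\<lambda>R. y / (exp R - y)) \<longlongrightarrow> 0) at_top" by real_asymp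
    from order_tendstoD(2)[OF this d(1)] have 1: "\<forall>\<^sub>F R in at_top. y / (exp R - y) < d" .
    have 2: "\<forall>\<^sub>F R in at_top. y < exp R" by real_asymp
    from right[OF d(1)] 1 2 show ?thesis
    proof eventually_elim
      case (elim R)
      show ?case
      proof (intro allI impI)
        fix v assume v: "\<bar>v\<bar> < pi"
        let ?z = "Complex R v"
        define K where "K = exp ?z / (exp ?z - of_real y)"
        have lb: "exp R - y \<le> norm (exp ?z - of_real y)"
          using norm_triangle_ineq2[of "exp ?z" "of_real y"] y by simp
        hence ne: "exp ?z - of_real y \<noteq> 0" using elim(3) by auto
        hence "K - 1 = of_real y / (exp ?z - of_real y)" by (simp add: K_def field_simps)
        hence "norm (K - 1) = y / norm (exp ?z - of_real y)" using y by (simp add: norm_divide)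
        also have "\<dots> \<le> y / (exp R - y)" using lb elim(3) y by (intro divide_left_mono mult_pos_pos) auto
        finally have K1: "norm (K - 1) \<le> d" using elim(2) by linarith
        hence K: "norm K \<le> 2" using norm_triangle_ineq[of "K - 1" 1] d(2) by simp
        have "?F ?z - 1 = (H ?z - 1) * K + (K - 1)" by (simp add: K_def left_diff_distrib diff_divide_distrib)
        also have "norm \<dots> \<le> norm (H ?z - 1) * norm K + norm (K - 1)"
          by (metis norm_mult norm_triangle_ineq)
        also have "\<dots> \<le> d * 2 + d" using elim(1) v K K1 d(1) by (intro add_mono mult_mono) auto
        also have "\<dots> \<le> e" using d by linarith
        finally show "norm (?F ?z - 1) \<le> e" .
      qed
    qed
  qed
  have leftF: "\<forall>\<^sub>F R in at_top. \<forall>v. \<bar>v\<bar> < pi \<longrightarrow> norm (?F (Complex (-R) v)) \<le> e" if e: "0 < e" for e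
  proof -
    \<comment> \<open>Once \<open>exp (- R)\<close> is at most \<open>y / 2\<close>, the denominator
      is at least \<open>y / 2\<close>, so the hypothesis \<open>left\<close> at level
      \<open>e * y / 2\<close> yields exactly \<open>e\<close>.\<close>
    have d: "0 < e * y / 2" using e y by simp
    have 1: "\<forall>\<^sub>F R in at_top. exp (- R) \<le> y / 2" using y by real_asymp
    from left[OF d] 1 show ?thesis
    proof eventually_elim
      case (elim R)
      show ?case
      proof (intro allI impI)
        fix v assume v: "\<bar>v\<bar> < pi"
        let ?z = "Complex (-R) v"
        have lb: "y / 2 \<le> norm (exp ?z - of_real y)"
          using norm_triangle_ineq2[of "of_real y" "exp ?z"] y elim(2) by (simp add: norm_minus_commute)
        have "norm (?F ?z) = norm (H ?z) * exp (-R) / norm (exp ?z - of_real y)" by (simp add: norm_mult norm_divide)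
        also have "\<dots> \<le> (e * y / 2) / (y / 2)" using elim(1) v lb y d by (intro frac_le) auto
        also have "\<dots> = e" using y by simp
        finally show "norm (?F ?z) \<le> e" .
      qed
    qed
  qed
  have Rln: "\<forall>\<^sub>F R in at_top. \<bar>ln y\<bar> < R" by (rule eventually_gt_at_top)
  have int: "?phi integrable_on {-R..R}" for R
  proof -
      \<comment> \<open>The estimate is available only for large \<open>R'\<close>; an arbitrary
        \<open>R\<close> is reached by restricting to a subinterval.\<close>
      have ev: "\<forall>\<^sub>F R' in at_top. R \<le> R' \<and> ?phi integrable_on {-R'..R'}"
        using rightF[of 1, OF zero_less_one] leftF[of 1, OF zero_less_one] Rln eventually_ge_at_top[of R]
      proof eventually_elim
        case (elim R')
        have r: "norm (?F (Complex R' v) - 1) \<le> 1" and l: "norm (?F (Complex (-R') v)) \<le> 1"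
          if "\<bar>v\<bar> < pi" for v using elim(1,2) that by blast+
        have "?phi integrable_on {-R'..R'}"
          by (rule boundary_integral_estimate(1)[OF hol cnj B dom bdry y elim(3) r l])
        with elim show ?case by blast
      qed
      obtain R' where R': "R \<le> R'" "?phi integrable_on {-R'..R'}"
        using eventually_happens'[OF trivial_limit_at_top_linorder ev] by blast
      show ?thesis by (rule integrable_on_subinterval[OF R'(2)]) (use R'(1) in simp)
  qed
  have lim: "((\<lambda>R. integral {-R..R} ?phi) \<longlongrightarrow> ?L) at_top"
  proof (rule tendstoI)
    fix e :: real assume "0 < e"
    hence e: "0 < e / (4 * pi)" by simp
    show "\<forall>\<^sub>F R in at_top. dist (integral {-R..R} ?phi) ?L < e"
      using rightF[OF e] leftF[OF e] Rln
    proof eventually_elim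
      case (elim R)
      have r: "norm (?F (Complex R v) - 1) \<le> e / (4 * pi)" and l: "norm (?F (Complex (-R) v)) \<le> e / (4 * pi)"
        if "\<bar>v\<bar> < pi" for v using elim(1,2) that by blast+
      have "\<bar>integral {-R..R} ?phi - ?L\<bar> \<le> 2 * pi * (e / (4 * pi))"
        by (rule boundary_integral_estimate(2)[OF hol cnj B dom bdry y elim(3) r l])
      thus ?case using \<open>0 < e\<close> by (simp add: dist_real_def)
    qed
  qed
  let ?f = "\<lambda>u. s * Im (H (Complex u pi)) * (exp u / (exp u + y))"
  have nn: "0 \<le> ?f u" for u
    using y by (intro mult_nonneg_nonneg[OF sgn] divide_nonneg_pos add_pos_pos) auto
  have "(?f has_integral s * ?L) UNIV"
  proof (rule has_integral_monotone_convergence_increasing)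
    let ?g = "\<lambda>n u. if u \<in> {- real n..real n} then ?f u else 0"
    show "(?g n has_integral s * integral {- real n..real n} ?phi) UNIV" for n
      using has_integral_mult_right[OF integrable_integral[OF int[of "real n"]], of s]
      unfolding has_integral_restrict_UNIV by (simp add: mult.assoc)
    show "?g n u \<le> ?g (Suc n) u" for n u using nn[of u] by auto
    show "(\<lambda>n. ?g n u) \<longlonglongrightarrow> ?f u" for u
    proof (rule tendsto_eventually)
      have "\<forall>\<^sub>F n in sequentially. \<bar>u\<bar> \<le> real n" by (rule eventually_sequentiallyI[of "nat \<lceil>\<bar>u\<bar>\<rceil>"]) linarith
      thus "\<forall>\<^sub>F n in sequentially. ?g n u = ?f u" by eventually_elim auto
    qed
    show "(\<lambda>n. s * integral {- real n..real n} ?phi) \<longlonglongrightarrow> s * ?L"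
      by (intro tendsto_intros filterlim_compose[OF lim filterlim_real_sequentially])
  qed
  note hi = this
  have fm: "?f \<in> borel_measurable borel" using strip_boundary_measurable[OF hol bdry] by measurable
  show ?thesis
    using nn_integral_has_integral_lborel[OF fm nn hi] has_integral_nonneg[OF hi] nn fm
    by (intro has_bochner_integral_nn_integral) auto
qed

subsection \<open>The logarithmic quotient in exponential coordinates\<close>

text \<open>
  The value \<open>0\<close> at the logarithmic singularity is a convention: the library leaves \<open>Ln 0\<close> unspecified.
\<close>
definition log_affine_exp :: "real \<Rightarrow> complex \<Rightarrow> complex" where
  "log_affine_exp q z =
    (let w = of_real (1 - q) + of_real q * exp z in if w = 0 then 0 else Ln w)"

text \<open>The value at \<open>0\<close> fills the removable singularity: for
  \<open>0 < q < 1\<close> it is the derivative of \<open>log_affine_exp q\<close> there.\<close>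

definition log_affine_exp_quot :: "real \<Rightarrow> complex \<Rightarrow> complex" where
  "log_affine_exp_quot q z = (if z = 0 then of_real q else log_affine_exp q z / z)"

section \<open>Integrable singularities and the complex logarithm\<close>

lemma integrable_on_abs_powr:
  assumes "-1 < (a::real)"
  shows "(\<lambda>u. \<bar>u - c\<bar> powr a) integrable_on {x..y}"
proof -
  \<comment> \<open>\<open>L\<close> is large enough for \<open>{c - L..c + L}\<close> to contain
    \<open>{x..y}\<close>; each half is a translate or a reflection of
    \<open>{0..L}\<close>.\<close>
  define L where "L = \<bar>x - c\<bar> + \<bar>y - c\<bar>"
  have L: "0 \<le> L" "c - L \<le> x" "y \<le> c + L" by (auto simp: L_def)
  have base: "(\<lambda>u. u powr a) integrable_on cbox 0 L"
    using integrable_on_powr_from_0[OF assms L(1)] by simp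
  have im: "(\<lambda>u::real. u + c) ` {0..L} = {c..c + L}" "(\<lambda>u::real. c - u) ` {0..L} = {c - L..c}"
    by (auto simp: image_iff intro: bexI[of _ "_ - c"] bexI[of _ "c - _"])
  have "(\<lambda>u. (u - c) powr a) integrable_on {c..c + L}"
    using integrable_affinity[OF base, of 1 "-c"] im(1) by (simp add: add.commute)
  hence 1: "(\<lambda>u. \<bar>u - c\<bar> powr a) integrable_on {c..c + L}"
    by (rule integrable_eq) auto
  have "(\<lambda>u. (c - u) powr a) integrable_on {c - L..c}"
    using integrable_affinity[OF base, of "-1" c] im(2) by simp
  hence 2: "(\<lambda>u. \<bar>u - c\<bar> powr a) integrable_on {c - L..c}"
    by (rule integrable_eq) auto
  have "(\<lambda>u. \<bar>u - c\<bar> powr a) integrable_on {c - L..c + L}"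
    using L by (intro Henstock_Kurzweil_Integration.integrable_combine[OF _ _ 2 1]) auto
  thus ?thesis by (rule integrable_on_subinterval) (use L in auto)
qed

text \<open>\<open>Ln\<close> jumps across the negative real axis but is continuous up to it from
  above: multiplication by -i carries the closed upper half-plane to the closed right half-plane,
  where \<open>Ln\<close> is continuous away from \<open>0\<close>.\<close>

lemma tendsto_Ln_upper_halfplane:
  assumes f: "(f \<longlongrightarrow> w) F" and w: "w \<noteq> 0" "0 \<le> Im w" and ev: "\<forall>\<^sub>F x in F. 0 \<le> Im (f x)"
  shows "((\<lambda>x. Ln (f x)) \<longlongrightarrow> Ln w) F"
proof -
  have eq: "Ln z = Ln (- \<i> * z) + \<i> * of_real pi / 2" if "z \<noteq> 0" "0 \<le> Im z" for z
    using Ln_times_ii[of "- \<i> * z"] that by simp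
  have nz: "\<forall>\<^sub>F x in F. f x \<noteq> 0" using tendsto_imp_eventually_ne[OF f w(1)] .
  have "- \<i> * w \<notin> \<real>\<^sub>\<le>\<^sub>0"
    using w by (auto simp: complex_nonpos_Reals_iff complex_eq_iff)
  hence "((\<lambda>x. Ln (- \<i> * f x) + \<i> * of_real pi / 2) \<longlongrightarrow> Ln (- \<i> * w) + \<i> * of_real pi / 2) F"
    by (intro tendsto_intros f)
  moreover have "\<forall>\<^sub>F x in F. Ln (- \<i> * f x) + \<i> * of_real pi / 2 = Ln (f x)"
    using nz ev by eventually_elim (rule eq[symmetric])
  ultimately show ?thesis
    unfolding eq[OF w] by (rule Lim_transform_eventually)
qed

lemma norm_Ln_le:
  assumes "w \<noteq> 0"
  shows "norm (Ln w) \<le> \<bar>ln (norm w)\<bar> + pi"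
proof -
  have "\<bar>Im (Ln w)\<bar> \<le> pi" using Im_Ln_le_pi[OF assms] mpi_less_Im_Ln[OF assms] by linarith
  thus ?thesis using cmod_le[of "Ln w"] assms by simp
qed

text \<open>If \<open>l = Ln w\<close> has norm at most 1, then \<open>norm (exp l - 1)\<close> is
  at most \<open>norm l * exp 1\<close>. The bound keeps the denominator of the reciprocal quotient
  away from \<open>0\<close>.\<close>

lemma norm_Ln_ge:
  assumes "w \<noteq> 0"
  shows "min 1 (norm (w - 1) / exp 1) \<le> norm (Ln w)"
proof (cases "norm (Ln w) \<le> 1")
  case True
  have "norm (w - 1) = norm (exp (Ln w) - 1)" using assms by simp
  also have "\<dots> \<le> norm (Ln w) * exp (norm (Ln w))"
    using Taylor_exp_field[of "Ln w" 0] by (simp add: mult.commute)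
  also have "\<dots> \<le> norm (Ln w) * exp 1" using True by (intro mult_left_mono) auto
  finally show ?thesis by (simp add: field_simps min_le_iff_disj)
qed auto

section \<open>Holomorphy, zeros and symmetry in the open strip\<close>

context
  fixes q :: real
  assumes q: "0 < q" "q < 1"
begin

private abbreviation (input) w where "w z \<equiv> of_real (1 - q) + of_real q * exp z :: complex"

text \<open>A real value forces \<open>sin (Im z) = 0\<close>, in the strip therefore
  \<open>Im z = 0\<close>, and there the value is positive. Hence the principal logarithm meets no
  branch cut.\<close>

lemma affine_exp_not_nonpos:
  assumes "\<bar>Im z\<bar> < pi"
  shows "w z \<notin> \<real>\<^sub>\<le>\<^sub>0"
proof
  assume "w z \<in> \<real>\<^sub>\<le>\<^sub>0"
  hence im: "q * (exp (Re z) * sin (Im z)) = 0" and re: "1 - q + q * (exp (Re z) * cos (Im z)) \<le> 0"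
    by (auto simp: complex_nonpos_Reals_iff Re_exp Im_exp)
  have "sin (Im z) = 0" using im q by simp
  hence "Im z = 0" using assms sin_gt_zero[of "Im z"] sin_gt_zero[of "- Im z"] by (cases "Im z" "0::real" rule: linorder_cases) auto
  thus False using re q by (smt (verit) cos_zero exp_gt_zero mult_pos_pos mult.right_neutral)
qed

lemma affine_exp_nonzero: "\<bar>Im z\<bar> < pi \<Longrightarrow> w z \<noteq> 0"
  using affine_exp_not_nonpos[of z] by fastforce

lemma log_affine_exp_eq_Ln: "w z \<noteq> 0 \<Longrightarrow> log_affine_exp q z = Ln (w z)"
  unfolding log_affine_exp_def Let_def by (rule if_not_P)

lemma log_affine_exp_0 [simp]: "log_affine_exp q 0 = 0"
  by (simp add: log_affine_exp_def Let_def)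

text \<open>A vanishing logarithm means \<open>w z = 1\<close>, that is \<open>exp z = 1\<close>,
  and \<open>exp\<close> is injective on the strip.\<close>

lemma log_affine_exp_nonzero:
  assumes "\<bar>Im z\<bar> < pi" "z \<noteq> 0"
  shows "log_affine_exp q z \<noteq> 0"
proof
  assume "log_affine_exp q z = 0"
  hence "exp (Ln (w z)) = 1" by (simp only: log_affine_exp_eq_Ln[OF affine_exp_nonzero[OF assms(1)]] exp_zero)
  hence "w z = 1" using affine_exp_nonzero[OF assms(1)] by simp
  hence "of_real q * (exp z - 1) = 0" by (simp add: algebra_simps)
  hence "exp z = exp 0" using q by simp
  moreover have "\<bar>Im z - Im 0\<bar> < 2 * pi" using assms by simp
  ultimately show False using exp_complex_eqI[of z 0] assms(2) by blast
qed

lemma log_affine_exp_quot_nonzero: "\<bar>Im z\<bar> < pi \<Longrightarrow> log_affine_exp_quot q z \<noteq> 0"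
  using q log_affine_exp_nonzero[of z] by (simp add: log_affine_exp_quot_def)

lemma holomorphic_log_affine_exp_quot: "log_affine_exp_quot q holomorphic_on {z. \<bar>Im z\<bar> < pi}"
proof -
  have eq: "Ln (w z) = log_affine_exp q z" if "z \<in> {z. \<bar>Im z\<bar> < pi}" for z
    using that by (intro log_affine_exp_eq_Ln[symmetric] affine_exp_nonzero) auto
  have "(\<lambda>z. Ln (w z)) holomorphic_on {z. \<bar>Im z\<bar> < pi}"
    by (intro holomorphic_intros) (use affine_exp_not_nonpos in auto)
  hence hol: "log_affine_exp q holomorphic_on {z. \<bar>Im z\<bar> < pi}"
    by (rule holomorphic_transform) (rule eq)
  have "((\<lambda>z. Ln (w z)) has_field_derivative of_real q) (at 0)"
    by (auto intro!: derivative_eq_intros)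
  hence "(log_affine_exp q has_field_derivative of_real q) (at 0)"
    by (rule has_field_derivative_transform_within_open[OF _ open_strip _ eq]) auto
  hence "deriv (log_affine_exp q) 0 = of_real q" by (rule DERIV_imp_deriv)
  \<comment> \<open>\<open>log_affine_exp q\<close> vanishes at \<open>0\<close>, so the quotient by
    \<open>z\<close> is its difference quotient; completed by the derivative, it is
    holomorphic.\<close>
  with pole_lemma_open[OF hol open_strip, of 0] show ?thesis
    by (simp add: log_affine_exp_quot_def[abs_def] cong: if_cong)
qed

lemma log_affine_exp_quot_cnj:
  assumes "\<bar>Im z\<bar> < pi"
  shows "log_affine_exp_quot q (cnj z) = cnj (log_affine_exp_quot q z)"
proof -
  have "cnj (Ln (w z)) = Ln (cnj (w z))" by (rule cnj_Ln[OF affine_exp_not_nonpos[OF assms]])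
  moreover have "w (cnj z) = cnj (w z)" by (simp add: exp_cnj)
  ultimately have "log_affine_exp q (cnj z) = cnj (log_affine_exp q z)"
    by (simp only: log_affine_exp_def Let_def complex_cnj_zero_iff if_distrib[of cnj] complex_cnj_zero)
  thus ?thesis by (simp add: log_affine_exp_quot_def)
qed

section \<open>Bounds in the upper part of the strip\<close>

lemma norm_affine_exp_ge: "\<bar>q * exp (Re z) - (1 - q)\<bar> \<le> norm (w z)"
proof -
  have 1: "norm (of_real q * exp z) = q * exp (Re z)" "norm (- complex_of_real (1 - q)) = 1 - q"
    using q by (simp_all only: norm_mult norm_of_real norm_exp_eq_Re norm_minus_cancel)
  have 2: "of_real q * exp z - (- of_real (1 - q)) = w z" by simp
  show ?thesis
    using norm_triangle_ineq3[of "of_real q * exp z" "- of_real (1 - q)"] unfolding 1 2 .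
qed

lemma norm_affine_exp_le: "norm (w z) \<le> 1 - q + q * exp (Re z)"
proof -
  have "norm (of_real q * exp z) = q * exp (Re z)" "norm (complex_of_real (1 - q)) = 1 - q"
    using q by (simp_all only: norm_mult norm_of_real norm_exp_eq_Re)
  thus ?thesis using norm_triangle_ineq[of "of_real (1 - q)" "of_real q * exp z"] by simp
qed

text \<open>At \<open>c\<close> the two terms of \<open>w\<close> have equal modulus;
  \<open>Complex c pi\<close> is the zero of \<open>w\<close> on the boundary line. The inequality
  \<open>1 + t <= exp t\<close> makes the modulus grow at least linearly away from \<open>c\<close>,
  uniformly over the given range of \<open>Re z\<close>.\<close>

lemma affine_exp_gap:
  assumes "\<bar>Re z\<bar> \<le> R"
  defines "c \<equiv> ln ((1 - q) / q)"
  shows "q * exp (- (R + \<bar>c\<bar>)) * \<bar>Re z - c\<bar> \<le> norm (w z)"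
proof -
  have qec: "q * exp c = 1 - q" using q by (simp add: c_def)
  have "exp (- (R + \<bar>c\<bar>)) * \<bar>Re z - c\<bar> \<le> \<bar>exp (Re z) - exp c\<bar>"
  proof (cases "c \<le> Re z")
    case True
    have "exp (- (R + \<bar>c\<bar>)) * (Re z - c) \<le> exp c * (Re z - c)" using assms(1) True by (intro mult_right_mono) auto
    also have "\<dots> \<le> exp c * (exp (Re z - c) - 1)" using exp_ge_add_one_self[of "Re z - c"] by (intro mult_left_mono) (linarith, simp)
    also have "\<dots> = exp (Re z) - exp c" by (simp add: exp_diff right_diff_distrib)
    finally show ?thesis using True by simp
  next
    case False
    have "exp (- (R + \<bar>c\<bar>)) * (c - Re z) \<le> exp (Re z) * (c - Re z)" using assms(1) False by (intro mult_right_mono) auto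
    also have "\<dots> \<le> exp (Re z) * (exp (c - Re z) - 1)" using exp_ge_add_one_self[of "c - Re z"] by (intro mult_left_mono) (linarith, simp)
    also have "\<dots> = exp c - exp (Re z)" by (simp add: exp_diff right_diff_distrib)
    finally show ?thesis using False by simp
  qed
  hence "q * (exp (- (R + \<bar>c\<bar>)) * \<bar>Re z - c\<bar>) \<le> q * \<bar>exp (Re z) - exp c\<bar>" using q by (intro mult_left_mono) auto
  also have "\<dots> = \<bar>q * (exp (Re z) - exp c)\<bar>" using q by (simp add: abs_mult)
  also have "q * (exp (Re z) - exp c) = q * exp (Re z) - (1 - q)"
    by (simp only: right_diff_distrib qec)
  also note norm_affine_exp_ge
  finally show ?thesis by (simp add: mult.assoc)
qed

text \<open>This is the dominating function for the boundary limit. The logarithmic singularity at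
  \<open>c\<close> is traded for a power: \<open>- ln t = 2 * ln (t powr (-1/2))\<close>, which is
  at most \<open>2 * t powr (-1/2)\<close>, and an exponent above -1 is integrable. Division by
  \<open>z\<close> costs nothing, as \<open>norm z\<close> is at least 1.\<close>

lemma norm_log_affine_exp_quot_le:
  assumes "\<bar>u\<bar> \<le> R" "pi / 2 \<le> v" "v < pi"
  defines "c \<equiv> ln ((1 - q) / q)"
  assumes "u \<noteq> c"
  defines "k \<equiv> q * exp (- (R + \<bar>c\<bar>))"
  shows "norm (log_affine_exp_quot q (Complex u v)) \<le> (1 + exp R + pi) + 2 * k powr (-1/2) * \<bar>u - c\<bar> powr (-1/2)"
proof -
  let ?z = "Complex u v"
  have k: "0 < k" using q by (simp add: k_def)
  have nz: "w ?z \<noteq> 0" using assms by (intro affine_exp_nonzero) auto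
  note lz = log_affine_exp_eq_Ln[OF nz]
  have t: "0 < k * \<bar>u - c\<bar>" using k assms by simp
  have lo: "k * \<bar>u - c\<bar> \<le> norm (w ?z)" using affine_exp_gap[of ?z R] assms by simp
  have "norm (w ?z) \<le> 1 - q + q * exp u" using norm_affine_exp_le[of ?z] by simp
  also have "\<dots> \<le> 1 + 1 * exp R" using q assms by (intro add_mono mult_mono) auto
  finally have "ln (norm (w ?z)) \<le> 1 + exp R" using nz ln_le_minus_one[of "norm (w ?z)"] by simp
  moreover have "- ln (norm (w ?z)) \<le> 2 * k powr (-1/2) * \<bar>u - c\<bar> powr (-1/2)"
  proof -
    have "- ln (norm (w ?z)) \<le> - ln (k * \<bar>u - c\<bar>)" using lo t by (subst neg_le_iff_le, subst ln_le_cancel_iff) auto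
    also have "\<dots> = 2 * ln ((k * \<bar>u - c\<bar>) powr (-1/2))" using t by (simp add: ln_powr)
    also have "\<dots> \<le> 2 * (k * \<bar>u - c\<bar>) powr (-1/2)"
    proof -
      have "0 < (k * \<bar>u - c\<bar>) powr (-1/2)" using t by (simp only: powr_gt_zero)
      from ln_le_minus_one[OF this] show ?thesis by linarith
    qed
    also have "\<dots> = 2 * k powr (-1/2) * \<bar>u - c\<bar> powr (-1/2)" using k by (simp add: powr_mult)
    finally show ?thesis .
  qed
  moreover have "0 \<le> 2 * k powr (-1/2) * \<bar>u - c\<bar> powr (-1/2)" by simp
  moreover have "0 \<le> 1 + exp R" using exp_gt_zero[of R] by linarith
  ultimately have "\<bar>ln (norm (w ?z))\<bar> + pi \<le> (1 + exp R + pi) + 2 * k powr (-1/2) * \<bar>u - c\<bar> powr (-1/2)" by linarith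
  moreover have "norm (log_affine_exp_quot q ?z) \<le> norm (Ln (w ?z))"
  proof -
    have "1 \<le> v" using assms pi_ge_two by linarith
    hence "1 \<le> norm ?z" using abs_Im_le_cmod[of ?z] by simp
    thus ?thesis using divide_left_mono[of 1 "norm ?z" "norm (Ln (w ?z))"]
      by (auto simp: log_affine_exp_quot_def lz norm_divide)
  qed
  ultimately show ?thesis using norm_Ln_le[OF nz] by linarith
qed

text \<open>The reciprocal has no singularity to dominate: \<open>cos v <= 0\<close> makes
  \<open>norm (exp z - 1)\<close> at least 1, so \<open>norm (w z - 1)\<close> is at least
  \<open>q\<close>, and \<open>norm_Ln_ge\<close> keeps the logarithm away from
  \<open>0\<close>.\<close>

lemma norm_inverse_log_affine_exp_quot_le:
  assumes "\<bar>u\<bar> \<le> R" "pi / 2 \<le> v" "v < pi"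
  shows "norm (inverse (log_affine_exp_quot q (Complex u v))) \<le> (R + pi) * exp 1 / q"
proof -
  let ?z = "Complex u v"
  have nz: "w ?z \<noteq> 0" using assms by (intro affine_exp_nonzero) auto
  note lz = log_affine_exp_eq_Ln[OF nz]
  have z: "?z \<noteq> 0" using assms pi_gt_zero by (auto simp: complex_eq_iff)
  have "1 \<le> norm (exp ?z - 1)"
  proof -
    have "cos v \<le> 0" using assms cos_monotone_0_pi_le[of "pi/2" v] by simp
    hence "exp u * cos v \<le> 0" by (simp add: mult_nonneg_nonpos)
    thus ?thesis using abs_Re_le_cmod[of "exp ?z - 1"] by (simp add: Re_exp)
  qed
  hence "q * 1 \<le> q * norm (exp ?z - 1)" using q by (intro mult_left_mono) auto
  also have "\<dots> = norm (of_real q * (exp ?z - 1))" using q by (simp add: norm_mult)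
  also have "of_real q * (exp ?z - 1) = w ?z - 1" by (simp add: algebra_simps)
  finally have "q / exp 1 \<le> norm (w ?z - 1) / exp 1" by (simp add: divide_right_mono)
  moreover have "q / exp 1 \<le> 1" using q exp_ge_add_one_self[of 1] by (simp add: field_simps)
  ultimately have lb: "q / exp 1 \<le> norm (Ln (w ?z))" using norm_Ln_ge[OF nz] by linarith
  have "norm ?z \<le> R + pi" using cmod_le[of ?z] assms pi_gt_zero by simp
  hence "norm ?z / norm (Ln (w ?z)) \<le> (R + pi) / (q / exp 1)"
    using lb q assms(1) pi_gt_zero by (intro frac_le) auto
  thus ?thesis using z by (simp add: log_affine_exp_quot_def lz norm_divide norm_inverse)
qed

section \<open>Boundary values on the line \<open>Im z = pi\<close>\<close>

lemma log_affine_exp_quot_boundary: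
  assumes "u \<noteq> ln ((1 - q) / q)"
  shows "((\<lambda>v. log_affine_exp_quot q (Complex u v)) \<longlongrightarrow> log_affine_exp_quot q (Complex u pi)) (at_left pi)"
proof -
  have lim: "((\<lambda>v. Complex u v) \<longlongrightarrow> Complex u pi) (at_left pi)"
    unfolding Complex_eq by (intro tendsto_intros)
  have wpi: "w (Complex u pi) = of_real (1 - q - q * exp u)"
    by (simp add: complex_eq_iff Re_exp Im_exp)
  have "1 - q - q * exp u \<noteq> 0"
  proof
    assume "1 - q - q * exp u = 0"
    hence "exp u = (1 - q) / q" using q by (simp add: field_simps)
    thus False using assms by (metis ln_exp)
  qed
  hence nz: "w (Complex u pi) \<noteq> 0" unfolding wpi by (simp only: of_real_eq_0_iff not_False_eq_True)
  have ev: "\<forall>\<^sub>F v in at_left pi. 0 < v \<and> v < pi"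
    using eventually_at_left_real[OF pi_gt_zero] by simp
  \<comment> \<open>The limit value of \<open>w\<close> is real and may be negative, hence on the
    cut of \<open>Ln\<close>; for \<open>0 < v < pi\<close> the approach runs through the upper
    half-plane because \<open>sin v\<close> is nonnegative.\<close>
  have "((\<lambda>v. Ln (w (Complex u v))) \<longlongrightarrow> Ln (w (Complex u pi))) (at_left pi)"
  proof (rule tendsto_Ln_upper_halfplane[OF _ nz])
    show "((\<lambda>v. w (Complex u v)) \<longlongrightarrow> w (Complex u pi)) (at_left pi)" by (intro tendsto_intros lim)
    show "0 \<le> Im (w (Complex u pi))" by (simp add: Im_exp)
    show "\<forall>\<^sub>F v in at_left pi. 0 \<le> Im (w (Complex u v))"
      using ev by eventually_elim (use q in \<open>simp add: Im_exp sin_ge_zero\<close>)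
  qed
  hence "((\<lambda>v. Ln (w (Complex u v)) / Complex u v) \<longlongrightarrow> Ln (w (Complex u pi)) / Complex u pi) (at_left pi)"
    by (intro tendsto_divide lim) (simp_all add: complex_eq_iff)
  moreover have "\<forall>\<^sub>F v in at_left pi. Ln (w (Complex u v)) / Complex u v = log_affine_exp_quot q (Complex u v)"
    using ev
  proof eventually_elim
    case (elim v)
    hence "w (Complex u v) \<noteq> 0" by (intro affine_exp_nonzero) auto
    moreover have "Complex u v \<noteq> 0" using elim by (simp add: complex_eq_iff)
    ultimately show ?case by (simp add: log_affine_exp_quot_def log_affine_exp_eq_Ln)
  qed
  moreover have "log_affine_exp_quot q (Complex u pi) = Ln (w (Complex u pi)) / Complex u pi"
    unfolding log_affine_exp_quot_def log_affine_exp_eq_Ln[OF nz] by (simp add: complex_eq_iff)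
  ultimately show ?thesis by (auto intro: Lim_transform_eventually)
qed

text \<open>On this line \<open>w\<close> is real, nonzero and below 1, so its logarithm cannot
  vanish. The boundary limit therefore passes to the reciprocal.\<close>

lemma log_affine_exp_quot_boundary_nonzero:
  assumes "u \<noteq> ln ((1 - q) / q)"
  shows "log_affine_exp_quot q (Complex u pi) \<noteq> 0"
proof -
  have wpi: "w (Complex u pi) = of_real (1 - q - q * exp u)"
    by (simp add: complex_eq_iff Re_exp Im_exp)
  have "1 - q - q * exp u \<noteq> 0"
  proof
    assume "1 - q - q * exp u = 0"
    hence "exp u = (1 - q) / q" using q by (simp add: field_simps)
    thus False using assms by (metis ln_exp)
  qed
  hence nz: "w (Complex u pi) \<noteq> 0" unfolding wpi by (simp only: of_real_eq_0_iff not_False_eq_True)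
  moreover have "1 - q - q * exp u \<noteq> 1"
    using q by (smt (verit) exp_gt_zero mult_pos_pos)
  ultimately have "Ln (w (Complex u pi)) \<noteq> 0"
    unfolding wpi by (metis exp_Ln exp_zero of_real_eq_1_iff)
  moreover have "Complex u pi \<noteq> 0" by (simp add: complex_eq_iff)
  ultimately show ?thesis by (simp add: log_affine_exp_quot_def log_affine_exp_eq_Ln[OF nz])
qed

text \<open>With \<open>l\<close> the logarithm, the sign is that of
  \<open>Im l * u - Re l * pi\<close>. If the real value \<open>x\<close> of \<open>w\<close> is
  positive, \<open>l = ln x\<close> is not positive because \<open>x < 1\<close>. If
  \<open>x\<close> is negative, \<open>l\<close> has imaginary part \<open>pi\<close> and real part
  \<open>ln (- x)\<close>, which is at most \<open>u\<close> since \<open>- x <= exp u\<close>. At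
  \<open>x = 0\<close> the conventional value \<open>0\<close> serves.\<close>

lemma Im_log_affine_exp_quot_boundary: "0 \<le> Im (log_affine_exp_quot q (Complex u pi))"
proof -
  define x where "x = 1 - q - q * exp u"
  have wpi: "w (Complex u pi) = of_real x"
    by (simp add: complex_eq_iff Re_exp Im_exp x_def)
  define l where "l = log_affine_exp q (Complex u pi)"
  have l: "l = (if x = 0 then 0 else Ln (of_real x))"
    unfolding l_def log_affine_exp_def Let_def wpi by simp
  have x1: "x < 1" "- x \<le> exp u"
  proof -
    have "0 < q * exp u" "q * exp u \<le> exp u" using q by simp_all
    thus "x < 1" "- x \<le> exp u" using q unfolding x_def by linarith+
  qed
  have "0 \<le> Im l * u - Re l * pi"
  proof (cases x "0::real" rule: linorder_cases)
    case greater
    hence "ln x \<le> 0" using x1 by simp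
    thus ?thesis using greater by (simp add: l Ln_of_real mult_nonpos_nonneg)
  next
    case equal
    thus ?thesis by (simp add: l)
  next
    case less
    have "ln (- x) \<le> ln (exp u)" using less x1(2) by (subst ln_le_cancel_iff) auto
    moreover have "Im l = pi" "Re l = ln (- x)" using less by (auto simp: l Im_Ln_eq_pi)
    ultimately show ?thesis by (simp add: mult.commute[of _ pi])
  qed
  thus ?thesis
    by (simp add: log_affine_exp_quot_def complex_eq_iff Im_divide divide_nonneg_nonneg flip: l_def)
qed

section \<open>Behaviour at the two ends of the strip\<close>

lemma log_affine_exp_quot_at_top:
  assumes e: "0 < e"
  shows "\<forall>\<^sub>F R in at_top. \<forall>v. \<bar>v\<bar> < pi \<longrightarrow> norm (log_affine_exp_quot q (Complex R v) - 1) \<le> e"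
proof -
  \<comment> \<open>\<open>C\<close> bounds \<open>norm (Ln (w z) - z)\<close>: the real part lies
    between \<open>ln (q / 2)\<close> and \<open>0\<close>, as \<open>norm (w z)\<close> lies
    between \<open>q / 2 * exp R\<close> and \<open>exp R\<close>, and both imaginary parts are at
    most \<open>pi\<close> in modulus. Division by \<open>norm z\<close>, which is at least
    \<open>R\<close>, makes this small.\<close>
  define C where "C = - ln (q / 2) + 2 * pi"
  have "((\<lambda>R. C / R) \<longlongrightarrow> 0) at_top" by real_asymp
  from order_tendstoD(2)[OF this e] have ev1: "\<forall>\<^sub>F R in at_top. C / R < e" .
  have ev2: "\<forall>\<^sub>F R in at_top. 2 * (1 - q) / q \<le> exp R" using q by real_asymp
  show ?thesis
    using ev1 ev2 eventually_gt_at_top[of 0]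
  proof eventually_elim
    case (elim R)
    show ?case
    proof (intro allI impI)
      fix v :: real assume v: "\<bar>v\<bar> < pi"
      let ?z = "Complex R v"
      have nz: "w ?z \<noteq> 0" using v by (intro affine_exp_nonzero) auto
      note lz = log_affine_exp_eq_Ln[OF nz]
      have z: "?z \<noteq> 0" "R \<le> norm ?z" using elim(3) abs_Re_le_cmod[of ?z] by (auto simp: complex_eq_iff)
      have "q / 2 * exp R \<le> q * exp R - (1 - q)" using elim(2) q by (simp add: field_simps)
      also have "\<dots> \<le> norm (w ?z)" using norm_affine_exp_ge[of ?z] by simp
      finally have "ln (q / 2 * exp R) \<le> ln (norm (w ?z))" using q nz by (subst ln_le_cancel_iff) auto
      moreover have "ln (q / 2 * exp R) = ln (q / 2) + R" using q by (subst ln_mult_pos) auto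
      moreover have "norm (w ?z) \<le> exp R"
      proof -
        have "norm (w ?z) \<le> (1 - q) * 1 + q * exp R" using norm_affine_exp_le[of ?z] by simp
        also have "\<dots> \<le> (1 - q) * exp R + q * exp R" using q elim(3) by (intro add_right_mono mult_left_mono) auto
        also have "\<dots> = exp R" by (simp add: algebra_simps)
        finally show ?thesis .
      qed
      hence "ln (norm (w ?z)) \<le> ln (exp R)" using nz by (subst ln_le_cancel_iff) auto
      ultimately have "\<bar>Re (Ln (w ?z) - ?z)\<bar> \<le> - ln (q / 2)" using nz by simp
      moreover have "\<bar>Im (Ln (w ?z) - ?z)\<bar> \<le> 2 * pi"
        using Im_Ln_le_pi[OF nz] mpi_less_Im_Ln[OF nz] v by simp
      ultimately have "norm (Ln (w ?z) - ?z) \<le> C" using cmod_le[of "Ln (w ?z) - ?z"] by (simp add: C_def)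
      moreover have "log_affine_exp_quot q ?z - 1 = (Ln (w ?z) - ?z) / ?z"
        using z by (simp add: log_affine_exp_quot_def lz diff_divide_distrib)
      ultimately have "norm (log_affine_exp_quot q ?z - 1) \<le> C / R"
        using z elim(3) order_trans[OF norm_ge_zero, of "Ln (w ?z) - ?z" C]
        by (simp only: norm_divide) (intro frac_le, auto)
      thus "norm (log_affine_exp_quot q ?z - 1) \<le> e" using elim(1) by linarith
    qed
  qed
qed

lemma inverse_log_affine_exp_quot_at_top:
  assumes e: "0 < e"
  shows "\<forall>\<^sub>F R in at_top. \<forall>v. \<bar>v\<bar> < pi \<longrightarrow> norm (inverse (log_affine_exp_quot q (Complex R v)) - 1) \<le> e"
proof -
  \<comment> \<open>\<open>d <= 1/2\<close> keeps \<open>norm ?g\<close> at least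
    \<open>1 / 2\<close>, so passing to the reciprocal at most doubles the error.\<close>
  define d where "d = min (1/2) (e / 2)"
  have d: "0 < d" "d \<le> 1/2" "d \<le> e / 2" using e by (auto simp: d_def)
  from log_affine_exp_quot_at_top[OF d(1)] show ?thesis
  proof eventually_elim
    case (elim R)
    show ?case
    proof (intro allI impI)
      fix v assume v: "\<bar>v\<bar> < pi"
      let ?g = "log_affine_exp_quot q (Complex R v)"
      have nz: "?g \<noteq> 0" using v by (intro log_affine_exp_quot_nonzero) auto
      have g: "norm (?g - 1) \<le> d" using elim v by blast
      have "1 - norm (?g - 1) \<le> norm ?g" using norm_triangle_ineq2[of 1 "1 - ?g"] by (simp add: norm_minus_commute)
      hence g2: "1 / 2 \<le> norm ?g" using g d(2) by linarith
      have "inverse ?g - 1 = (1 - ?g) / ?g" using nz by (simp add: field_simps)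
      hence "norm (inverse ?g - 1) = norm (?g - 1) / norm ?g" by (simp add: norm_divide norm_minus_commute)
      also have "\<dots> \<le> d / (1 / 2)" using g g2 d by (intro frac_le) auto
      also have "\<dots> \<le> e" using d by simp
      finally show "norm (inverse ?g - 1) \<le> e" .
    qed
  qed
qed

lemma log_affine_exp_quot_at_bot:
  assumes e: "0 < e"
  shows "\<forall>\<^sub>F R in at_top. \<forall>v. \<bar>v\<bar> < pi \<longrightarrow> norm (log_affine_exp_quot q (Complex (-R) v)) * exp (-R) \<le> e"
proof -
  \<comment> \<open>At the left end \<open>norm (w z)\<close> lies between
    \<open>(1 - q) / 2\<close> and 1, so \<open>C\<close> bounds the logarithm and
    \<open>exp (-R)\<close> forces the decay.\<close>
  define C where "C = - ln ((1 - q) / 2) + pi"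
  have "((\<lambda>R. C * exp (-R)) \<longlongrightarrow> 0) at_top" by real_asymp
  from order_tendstoD(2)[OF this e] have ev1: "\<forall>\<^sub>F R in at_top. C * exp (-R) < e" .
  have ev2: "\<forall>\<^sub>F R in at_top. q * exp (-R) \<le> (1 - q) / 2" using q by real_asymp
  show ?thesis
    using ev1 ev2 eventually_ge_at_top[of 1]
  proof eventually_elim
    case (elim R)
    show ?case
    proof (intro allI impI)
      fix v :: real assume v: "\<bar>v\<bar> < pi"
      let ?z = "Complex (-R) v"
      have nz: "w ?z \<noteq> 0" using v by (intro affine_exp_nonzero) auto
      note lz = log_affine_exp_eq_Ln[OF nz]
      have z: "?z \<noteq> 0" "1 \<le> norm ?z" using elim(3) abs_Re_le_cmod[of ?z] by (auto simp: complex_eq_iff)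
      have "(1 - q) / 2 \<le> norm (w ?z)" using norm_affine_exp_ge[of ?z] elim(2) by simp
      hence lo: "ln ((1 - q) / 2) \<le> ln (norm (w ?z))" using q nz by (subst ln_le_cancel_iff) auto
      have "norm (w ?z) \<le> 1 - q + q * exp (-R)" using norm_affine_exp_le[of ?z] by simp
      moreover have "q * exp (-R) \<le> q" using elim(3) q by simp
      ultimately have "norm (w ?z) \<le> 1" by linarith
      hence "ln (norm (w ?z)) \<le> 0" using nz by simp
      with lo have "norm (Ln (w ?z)) \<le> C" using norm_Ln_le[OF nz] by (simp add: C_def)
      hence "norm (log_affine_exp_quot q ?z) \<le> C / 1"
        using z order_trans[OF norm_ge_zero, of "Ln (w ?z)" C]
        unfolding log_affine_exp_quot_def lz by (simp only: norm_divide if_False) (intro frac_le, auto)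
      hence "norm (log_affine_exp_quot q ?z) * exp (-R) \<le> C * exp (-R)" by (intro mult_right_mono) auto
      thus "norm (log_affine_exp_quot q ?z) * exp (-R) \<le> e" using elim(1) by linarith
    qed
  qed
qed

lemma inverse_log_affine_exp_quot_at_bot:
  assumes e: "0 < e"
  shows "\<forall>\<^sub>F R in at_top. \<forall>v. \<bar>v\<bar> < pi \<longrightarrow> norm (inverse (log_affine_exp_quot q (Complex (-R) v))) * exp (-R) \<le> e"
proof -
  \<comment> \<open>Here \<open>norm (w z)\<close> is at most \<open>1 - q / 2 < 1\<close>, so the
    logarithm has norm at least \<open>k > 0\<close> and the reciprocal grows at most linearly in
    \<open>R\<close>.\<close>
  define k where "k = - ln (1 - q / 2)"
  have k: "0 < k" using q by (simp add: k_def)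
  have "((\<lambda>R. (R + pi) / k * exp (-R)) \<longlongrightarrow> 0) at_top" using k by real_asymp
  from order_tendstoD(2)[OF this e] have ev1: "\<forall>\<^sub>F R in at_top. (R + pi) / k * exp (-R) < e" .
  have ev2: "\<forall>\<^sub>F R in at_top. q * exp (-R) \<le> q / 2" using q by real_asymp
  show ?thesis
    using ev1 ev2 eventually_ge_at_top[of 1]
  proof eventually_elim
    case (elim R)
    show ?case
    proof (intro allI impI)
      fix v :: real assume v: "\<bar>v\<bar> < pi"
      let ?z = "Complex (-R) v"
      have nz: "w ?z \<noteq> 0" using v by (intro affine_exp_nonzero) auto
      note lz = log_affine_exp_eq_Ln[OF nz]
      have z: "?z \<noteq> 0" "norm ?z \<le> R + pi" using elim(3) cmod_le[of ?z] v by (auto simp: complex_eq_iff)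
      have "norm (w ?z) \<le> 1 - q + q * exp (-R)" using norm_affine_exp_le[of ?z] by simp
      hence "norm (w ?z) \<le> 1 - q / 2" using elim(2) by linarith
      hence "ln (norm (w ?z)) \<le> ln (1 - q / 2)" using nz q by (subst ln_le_cancel_iff) auto
      hence "k \<le> norm (Ln (w ?z))" using abs_Re_le_cmod[of "Ln (w ?z)"] nz by (simp add: k_def)
      hence "norm ?z / norm (Ln (w ?z)) \<le> (R + pi) / k" using z k elim(3) pi_gt_zero by (intro frac_le) auto
      hence "norm (inverse (log_affine_exp_quot q ?z)) \<le> (R + pi) / k"
        using z by (simp add: log_affine_exp_quot_def lz norm_divide norm_inverse)
      hence "norm (inverse (log_affine_exp_quot q ?z)) * exp (-R) \<le> (R + pi) / k * exp (-R)" by (intro mult_right_mono) auto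
      thus "norm (inverse (log_affine_exp_quot q ?z)) * exp (-R) \<le> e" using elim(1) by linarith
    qed
  qed
qed

section \<open>The two integral representations\<close>

lemma log_affine_exp_quot_ln:
  assumes "0 < y"
  shows "log_affine_exp_quot q (of_real (ln y)) = of_real (if y = 1 then q else ln (1 - q + q * y) / ln y)"
proof -
  have pos: "0 < 1 - q + q * y" using q assms by (simp add: add_pos_pos)
  have "exp (complex_of_real (ln y)) = of_real y" by (subst exp_of_real) (use assms in simp)
  hence w: "w (of_real (ln y)) = of_real (1 - q + q * y)" by (simp only: of_real_add of_real_mult)
  have "log_affine_exp q (of_real (ln y)) = of_real (ln (1 - q + q * y))"
    unfolding log_affine_exp_def Let_def w Ln_of_real[OF pos] using pos by (simp only: of_real_eq_0_iff) simp
  thus ?thesis using assms by (simp add: log_affine_exp_quot_def)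
qed

lemma log_affine_exp_quot_representation:
  assumes "0 < y"
  shows "has_bochner_integral lborel (\<lambda>u. Im (log_affine_exp_quot q (Complex u pi)) * (exp u / (exp u + y)))
           (pi * (1 - (if y = 1 then q else ln (1 - q + q * y) / ln y)))"
proof -
  define c where "c = ln ((1 - q) / q)"
  have "has_bochner_integral lborel (\<lambda>u. 1 * Im (log_affine_exp_quot q (Complex u pi)) * (exp u / (exp u + y)))
           (1 * (pi * (1 - Re (log_affine_exp_quot q (of_real (ln y))))))"
  proof (rule strip_representation[OF holomorphic_log_affine_exp_quot log_affine_exp_quot_cnj _ norm_log_affine_exp_quot_le[folded c_def]
        log_affine_exp_quot_boundary[folded c_def] log_affine_exp_quot_at_top log_affine_exp_quot_at_bot])
    show "(\<lambda>u. (1 + exp R + pi) + 2 * (q * exp (- (R + \<bar>c\<bar>))) powr (-1/2) * \<bar>u - c\<bar> powr (-1/2)) integrable_on {-R..R}" for R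
      by (intro integrable_add integrable_const_ivl integrable_on_mult_right integrable_on_abs_powr) auto
  qed (use assms Im_log_affine_exp_quot_boundary in auto)
  thus ?thesis unfolding log_affine_exp_quot_ln[OF assms] by simp
qed

lemma inverse_log_affine_exp_quot_representation:
  assumes "0 < y"
  shows "has_bochner_integral lborel (\<lambda>u. - Im (inverse (log_affine_exp_quot q (Complex u pi))) * (exp u / (exp u + y)))
           (pi * (inverse (if y = 1 then q else ln (1 - q + q * y) / ln y) - 1))"
proof -
  define c where "c = ln ((1 - q) / q)"
  let ?H = "\<lambda>z. inverse (log_affine_exp_quot q z)"
  \<comment> \<open>Here \<open>s = - 1\<close>, since taking reciprocals reverses the sign of the
    imaginary part.\<close>
  have "has_bochner_integral lborel (\<lambda>u. - 1 * Im (?H (Complex u pi)) * (exp u / (exp u + y)))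
           (- 1 * (pi * (1 - Re (?H (of_real (ln y))))))"
  proof (rule strip_representation[OF _ _ _ norm_inverse_log_affine_exp_quot_le
        _ inverse_log_affine_exp_quot_at_top inverse_log_affine_exp_quot_at_bot])
    show "?H holomorphic_on {z. \<bar>Im z\<bar> < pi}"
      using log_affine_exp_quot_nonzero by (intro holomorphic_on_inverse holomorphic_log_affine_exp_quot) auto
    show "?H (cnj z) = cnj (?H z)" if "\<bar>Im z\<bar> < pi" for z
      using log_affine_exp_quot_cnj[OF that] by simp
    show "(\<lambda>u. (R + pi) * exp 1 / q) integrable_on {-R..R}" for R by (rule integrable_const_ivl)
    show "((\<lambda>v. ?H (Complex u v)) \<longlongrightarrow> ?H (Complex u pi)) (at_left pi)" if "u \<noteq> c" for u
      using log_affine_exp_quot_boundary[of u] log_affine_exp_quot_boundary_nonzero[of u] that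
      unfolding c_def by (intro tendsto_inverse)
    show "0 \<le> - 1 * Im (?H (Complex u pi))" for u
      using Im_log_affine_exp_quot_boundary[of u] by (simp add: divide_nonneg_nonneg)
  qed (use assms in auto)
  thus ?thesis unfolding log_affine_exp_quot_ln[OF assms] by (simp add: right_diff_distrib flip: of_real_inverse)
qed

lemma log_affine_exp_quot_boundary_measurable:
  "(\<lambda>u. log_affine_exp_quot q (Complex u pi)) \<in> borel_measurable borel"
  by (rule strip_boundary_measurable[OF holomorphic_log_affine_exp_quot log_affine_exp_quot_boundary])

end

subsection \<open>Stieltjes and complete Bernstein functions from densities\<close>

lemma power_div_fact_le_exp:
  assumes "0 \<le> (x::real)"
  shows "x ^ n / fact n \<le> exp x"
proof -
  have "(\<Sum>i\<in>{n}. x ^ i /\<^sub>R fact i) \<le> (\<Sum>i. x ^ i /\<^sub>R fact i)"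
    using assms by (intro sum_le_suminf summable_exp_generic) auto
  thus ?thesis by (simp add: exp_def divide_inverse mult.commute)
qed

text \<open>The representing measure is the image under \<open>T\<close> of \<open>M\<close>
  weighted by \<open>w\<close>, so no change of variables has to be computed.\<close>

lemma Stieltjes_function_of_density:
  fixes w T :: "'a \<Rightarrow> real"
  assumes [measurable]: "w \<in> borel_measurable M" "T \<in> borel_measurable M"
    and w: "\<And>u. 0 \<le> w u" and T: "\<And>u. 0 \<le> T u"
    and f: "\<And>x. 0 < x \<Longrightarrow> has_bochner_integral M (\<lambda>u. w u / (x + T u)) (f x - c)"
    and c: "0 \<le> c"
  shows "Stieltjes_function f"
proof -
  let ?B = "restrict_space borel {0::real..}"
  define \<mu> where "\<mu> = distr (density M (\<lambda>u. ennreal (w u))) ?B T"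
  have Tm [measurable]: "T \<in> measurable (density M (\<lambda>u. ennreal (w u))) ?B"
    using T by (intro measurable_restrict_space2) auto
  have km: "(\<lambda>t. 1 / (x + t)) \<in> borel_measurable ?B" for x :: real
    by (intro measurable_restrict_space1) auto
  have int: "integrable \<mu> (\<lambda>t. 1 / (x + t))" "(\<integral>t. 1 / (x + t) \<partial>\<mu>) = f x - c" if "0 < x" for x
  proof -
    from f[OF that] have i: "integrable M (\<lambda>u. w u / (x + T u))" "(\<integral>u. w u / (x + T u) \<partial>M) = f x - c"
      by (auto simp: has_bochner_integral_iff)
    show "integrable \<mu> (\<lambda>t. 1 / (x + t))"
      unfolding \<mu>_def using i(1) w
      by (subst integrable_distr_eq[OF Tm km], subst integrable_density) auto
    show "(\<integral>t. 1 / (x + t) \<partial>\<mu>) = f x - c"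
      unfolding \<mu>_def using i(2) w
      by (subst integral_distr[OF Tm km], subst integral_density) auto
  qed
  have "0 \<le> f x" if "0 < x" for x
  proof -
    have "0 \<le> (\<integral>u. w u / (x + T u) \<partial>M)"
      using w T that by (intro integral_nonneg_AE AE_I2 divide_nonneg_nonneg add_nonneg_nonneg) auto
    thus ?thesis using f[OF that] c by (simp add: has_bochner_integral_iff)
  qed
  moreover have "sets \<mu> = sets ?B" by (simp add: \<mu>_def)
  ultimately show ?thesis
    unfolding Stieltjes_function_def using c int by (intro conjI exI[of _ c] exI[of _ \<mu>]) auto
qed

section \<open>Laplace transforms and complete monotonicity\<close>

locale laplace_density = sigma_finite_measure M for M :: "'a measure" +
  fixes w T :: "'a \<Rightarrow> real"
  assumes w_measurable [measurable]: "w \<in> borel_measurable M"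
    and T_measurable [measurable]: "T \<in> borel_measurable M"
    and w_nonneg: "\<And>u. 0 \<le> w u" and T_pos: "\<And>u. 0 < T u"
    and integrable_w_div_T: "integrable M (\<lambda>u. w u / T u)"
begin

text \<open>\<open>moment 0\<close> is the Laplace transform of the image under \<open>T\<close> of
  \<open>M\<close> weighted by \<open>w\<close>; \<open>moment n\<close> is its \<open>n\<close>-th
  derivative, taken under the integral sign.\<close>

definition moment :: "nat \<Rightarrow> real \<Rightarrow> real" where
  "moment n s = (\<integral>u. w u * (- T u) ^ n * exp (- s * T u) \<partial>M)"

text \<open>The term of index \<open>Suc n\<close> in the exponential series bounds
  \<open>T u ^ n * exp (- s * T u)\<close> by a constant over \<open>T u\<close>. The one extra
  power lets the integrability of \<open>w u / T u\<close> control every moment.\<close>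

lemma integrable_moment:
  assumes s: "0 < s"
  shows "integrable M (\<lambda>u. w u * (T u ^ n * exp (- s * T u)))"
proof (rule Bochner_Integration.integrable_bound)
  let ?C = "fact (Suc n) / s ^ Suc n"
  show "integrable M (\<lambda>u. ?C * (w u / T u))" using integrable_w_div_T by (rule integrable_mult_right)
  show "AE u in M. norm (w u * (T u ^ n * exp (- s * T u))) \<le> norm (?C * (w u / T u))"
  proof (intro AE_I2)
    fix u
    have "(s * T u) ^ Suc n / fact (Suc n) \<le> exp (s * T u)"
      using s T_pos[of u] by (intro power_div_fact_le_exp) simp
    hence "s ^ Suc n * T u ^ Suc n \<le> exp (s * T u) * fact (Suc n)"
      by (simp only: power_mult_distrib pos_divide_le_eq fact_gt_zero)
    hence "T u ^ n * exp (- s * T u) \<le> ?C / T u"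
      using s T_pos[of u] by (simp add: exp_minus field_simps del: fact_Suc)
    hence "w u * (T u ^ n * exp (- s * T u)) \<le> w u * (?C / T u)" by (intro mult_left_mono w_nonneg)
    thus "norm (w u * (T u ^ n * exp (- s * T u))) \<le> norm (?C * (w u / T u))"
      using s w_nonneg[of u] T_pos[of u] by (simp add: mult.commute mult.left_commute)
  qed
qed simp

lemma integrable_moment':
  assumes "0 < s"
  shows "integrable M (\<lambda>u. w u * (- T u) ^ n * exp (- s * T u))"
proof -
  have "(\<lambda>u. w u * (- T u) ^ n * exp (- s * T u)) = (\<lambda>u. (-1) ^ n * (w u * (T u ^ n * exp (- s * T u))))"
    by (auto simp: fun_eq_iff power_minus[of "T _"])
  thus ?thesis using integrable_moment[OF assms, of n] by simp
qed

lemma moment_has_derivative: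
  assumes s: "0 < s"
  shows "(moment n has_real_derivative moment (Suc n) s) (at s)"
proof -
  let ?F = "\<lambda>h u. w u * (- T u) ^ n * ((exp (- (s + h) * T u) - exp (- s * T u)) / h)"
  have "((\<lambda>h. \<integral>u. ?F h u \<partial>M) \<longlongrightarrow> moment (Suc n) s) (at 0)"
    unfolding tendsto_at_iff_sequentially
  proof (intro allI impI)
    fix X :: "nat \<Rightarrow> real" assume X: "\<forall>i. X i \<in> UNIV - {0}" "X \<longlonglongrightarrow> 0"
    \<comment> \<open>Increments below \<open>s / 2\<close> leave half of the exponential decay, so
      a moment integrand at \<open>s / 2\<close> can dominate the difference quotients.\<close>
    from tendstoD[OF X(2), of "s / 2"] s obtain N where N: "\<And>i. N \<le> i \<Longrightarrow> \<bar>X i\<bar> < s / 2"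
      by (auto simp: eventually_sequentially dist_real_def)
    have "(\<lambda>i. \<integral>u. ?F (X (i + N)) u \<partial>M) \<longlonglongrightarrow> (\<integral>u. w u * (- T u) ^ Suc n * exp (- s * T u) \<partial>M)"
    proof (rule integral_dominated_convergence)
      show "integrable M (\<lambda>u. w u * (T u ^ Suc n * exp (- (s / 2) * T u)))"
        using s by (intro integrable_moment) simp
      show "AE u in M. (\<lambda>i. ?F (X (i + N)) u) \<longlonglongrightarrow> w u * (- T u) ^ Suc n * exp (- s * T u)"
      proof (intro AE_I2)
        fix u
        have "((\<lambda>s. exp (- s * T u)) has_real_derivative - T u * exp (- s * T u)) (at s)"
          by (auto intro!: derivative_eq_intros)
        hence "((\<lambda>h. (exp (- (s + h) * T u) - exp (- s * T u)) / h) \<longlongrightarrow> - T u * exp (- s * T u)) (at 0)"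
          by (simp only: DERIV_def)
        moreover have "filterlim (\<lambda>i. X (i + N)) (at 0) sequentially"
          using X LIMSEQ_ignore_initial_segment[OF X(2), of N] by (simp add: filterlim_at)
        ultimately have "(\<lambda>i. (exp (- (s + X (i + N)) * T u) - exp (- s * T u)) / X (i + N)) \<longlonglongrightarrow> - T u * exp (- s * T u)"
          by (rule filterlim_compose)
        from tendsto_mult[OF tendsto_const[of "w u * (- T u) ^ n"] this]
        show "(\<lambda>i. ?F (X (i + N)) u) \<longlonglongrightarrow> w u * (- T u) ^ Suc n * exp (- s * T u)"
          by (simp add: mult_ac)
      qed
      show "AE u in M. norm (?F (X (i + N)) u) \<le> w u * (T u ^ Suc n * exp (- (s / 2) * T u))" for i
      proof (intro AE_I2)
        fix u
        define h where "h = X (i + N)"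
        have h: "h \<noteq> 0" "\<bar>h\<bar> \<le> s / 2" using X(1) N[of "i + N"] by (auto simp: h_def)
        have "exp (- (s + h) * T u) - exp (- s * T u) = exp (- s * T u) * (exp (- h * T u) - 1)"
          by (simp add: algebra_simps flip: exp_add)
        hence "\<bar>exp (- (s + h) * T u) - exp (- s * T u)\<bar> = exp (- s * T u) * \<bar>exp (- h * T u) - 1\<bar>"
          by (simp only: abs_mult abs_exp_cancel)
        \<comment> \<open>For real \<open>t\<close>, \<open>exp t - 1\<close> has modulus at most
          that of \<open>t\<close> times \<open>exp\<close> of that modulus; used with
          \<open>t = - h * T u\<close>.\<close>
        also have "\<dots> \<le> exp (- s * T u) * (\<bar>h\<bar> * T u * exp (\<bar>h\<bar> * T u))"
          using Taylor_exp_field[of "- h * T u" 0] T_pos[of u]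
          by (intro mult_left_mono) (simp_all add: abs_mult mult_ac)
        also have "\<dots> = (\<bar>h\<bar> * T u) * (exp (- s * T u) * exp (\<bar>h\<bar> * T u))" by (simp only: mult_ac)
        also have "\<dots> \<le> (\<bar>h\<bar> * T u) * exp (- (s / 2) * T u)"
        proof (rule mult_left_mono)
          have "\<bar>h\<bar> * T u \<le> s / 2 * T u" using h(2) T_pos[of u] by (intro mult_right_mono) auto
          hence "- s * T u + \<bar>h\<bar> * T u \<le> - (s / 2) * T u" by linarith
          thus "exp (- s * T u) * exp (\<bar>h\<bar> * T u) \<le> exp (- (s / 2) * T u)"
            by (simp only: exp_le_cancel_iff flip: exp_add)
        qed (use T_pos[of u] in simp)
        finally have "\<bar>exp (- (s + h) * T u) - exp (- s * T u)\<bar> \<le> \<bar>h\<bar> * (T u * exp (- (s / 2) * T u))"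
          by (simp only: mult.assoc)
        hence "\<bar>(exp (- (s + h) * T u) - exp (- s * T u)) / h\<bar> \<le> T u * exp (- (s / 2) * T u)"
          using h(1) by (simp add: abs_divide field_simps)
        hence "(w u * T u ^ n) * \<bar>(exp (- (s + h) * T u) - exp (- s * T u)) / h\<bar> \<le> (w u * T u ^ n) * (T u * exp (- (s / 2) * T u))"
          using w_nonneg[of u] T_pos[of u] by (intro mult_left_mono mult_nonneg_nonneg) auto
        thus "norm (?F (X (i + N)) u) \<le> w u * (T u ^ Suc n * exp (- (s / 2) * T u))"
          unfolding h_def[symmetric] using w_nonneg[of u] T_pos[of u]
          by (simp add: abs_mult power_abs mult_ac)
      qed
    qed simp_all
    hence "(\<lambda>i. \<integral>u. ?F (X i) u \<partial>M) \<longlonglongrightarrow> moment (Suc n) s"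
      unfolding moment_def by (rule LIMSEQ_offset)
    thus "((\<lambda>h. \<integral>u. ?F h u \<partial>M) \<circ> X) \<longlonglongrightarrow> moment (Suc n) s" by (simp add: o_def)
  qed
  moreover have "\<forall>\<^sub>F h in at 0. (\<integral>u. ?F h u \<partial>M) = (moment n (s + h) - moment n s) / h"
  proof -
    have "\<forall>\<^sub>F h in at 0. h \<in> {- s<..<s} - {0}"
      using s by (intro eventually_at_in_open) auto
    thus ?thesis
    proof eventually_elim
      case (elim h)
      have "(moment n (s + h) - moment n s) / h =
        (\<integral>u. w u * (- T u) ^ n * exp (- (s + h) * T u) - w u * (- T u) ^ n * exp (- s * T u) \<partial>M) / h"
        unfolding moment_def using s elim
        by (subst Bochner_Integration.integral_diff[OF integrable_moment' integrable_moment']) auto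
      also have "\<dots> = (\<integral>u. (w u * (- T u) ^ n * exp (- (s + h) * T u) - w u * (- T u) ^ n * exp (- s * T u)) / h \<partial>M)"
        by simp
      also have "\<dots> = (\<integral>u. ?F h u \<partial>M)"
        by (intro Bochner_Integration.integral_cong) (auto simp: right_diff_distrib)
      finally show ?case by (rule sym)
    qed
  qed
  ultimately show ?thesis unfolding DERIV_def by (rule Lim_transform_eventually)
qed

lemma higher_deriv_moment:
  assumes "0 < s"
  shows "(deriv ^^ n) (moment 0) s = moment n s"
  using assms
proof (induction n arbitrary: s)
  case (Suc n)
  have "((deriv ^^ n) (moment 0) has_real_derivative moment (Suc n) s) (at s)"
    \<comment> \<open>The derivative at \<open>s\<close> needs the induction hypothesis at all
      nearby points, hence the open set \<open>{0<..}\<close>.\<close>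
    using Suc by (intro has_field_derivative_transform_within_open[OF moment_has_derivative, where S = "{0<..}"]) auto
  thus ?case by (simp add: DERIV_imp_deriv)
qed simp

lemma completely_monotonic_moment: "completely_monotonic (moment 0)"
proof -
  have pos: "0 \<le> (-1) ^ n * moment n s" for n s
  proof -
    have "(-1) ^ n * moment n s = (\<integral>u. (-1) ^ n * (w u * (- T u) ^ n * exp (- s * T u)) \<partial>M)"
      by (simp add: moment_def)
    also have "\<dots> = (\<integral>u. w u * (T u ^ n * exp (- s * T u)) \<partial>M)"
      by (intro Bochner_Integration.integral_cong) (auto simp: power_minus[of "T _"])
    also have "\<dots> \<ge> 0"
      using w_nonneg T_pos by (intro integral_nonneg_AE AE_I2 mult_nonneg_nonneg) (auto simp: less_imp_le)
    finally show ?thesis .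
  qed
  have "(deriv ^^ n) (moment 0) field_differentiable (at s)" if "0 < s" for n s
  proof -
    have "((deriv ^^ n) (moment 0) has_real_derivative moment (Suc n) s) (at s)"
      using that higher_deriv_moment
      by (intro has_field_derivative_transform_within_open[OF moment_has_derivative, where S = "{0<..}"]) auto
    thus ?thesis by (auto simp: field_differentiable_def)
  qed
  thus ?thesis
    unfolding completely_monotonic_def smooth_on_pos_def using pos pos[of 0] by (auto simp: higher_deriv_moment)
qed

text \<open>Tonelli, with \<open>1 / (x + T u)\<close> as the integral of
  \<open>exp (- (x + T u) * s)\<close> over \<open>s > 0\<close>. The case \<open>x = 0\<close> is
  included because \<open>T u > 0\<close>; it says that \<open>moment 0\<close> itself is integrable
  on the half-line.\<close>

lemma has_bochner_integral_exp_moment: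
  assumes x: "0 \<le> x"
  shows "has_bochner_integral lborel (\<lambda>s. indicator {0<..} s * (exp (- x * s) * moment 0 s)) (\<integral>u. w u / (x + T u) \<partial>M)"
proof (rule has_bochner_integral_nn_integral)
  have m_nonneg: "0 \<le> moment 0 s" for s
    unfolding moment_def using w_nonneg by (intro integral_nonneg_AE AE_I2 mult_nonneg_nonneg) auto
  have [measurable]: "moment 0 \<in> borel_measurable borel"
    unfolding moment_def[abs_def] by measurable
  show "(\<lambda>s. indicator {0<..} s * (exp (- x * s) * moment 0 s)) \<in> borel_measurable lborel" by measurable
  show "AE s in lborel. 0 \<le> indicator {0<..} s * (exp (- x * s) * moment 0 s)"
    using m_nonneg by (auto simp: indicator_def)
  show "0 \<le> (\<integral>u. w u / (x + T u) \<partial>M)"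
    using w_nonneg T_pos x by (intro integral_nonneg_AE AE_I2 divide_nonneg_nonneg add_nonneg_nonneg) (auto simp: less_imp_le)
  interpret L: pair_sigma_finite M lborel ..
  have "(\<integral>\<^sup>+s. ennreal (indicator {0<..} s * (exp (- x * s) * moment 0 s)) \<partial>lborel)
      = (\<integral>\<^sup>+s. \<integral>\<^sup>+u. ennreal (indicator {0<..} s * (w u * exp (- (x + T u) * s))) \<partial>M \<partial>lborel)"
  proof (intro nn_integral_cong)
    fix s :: real
    show "ennreal (indicator {0<..} s * (exp (- x * s) * moment 0 s))
      = (\<integral>\<^sup>+u. ennreal (indicator {0<..} s * (w u * exp (- (x + T u) * s))) \<partial>M)"
    proof (cases "0 < s")
      case True
      have exp_split: "exp (- x * s) * (w u * exp (- s * T u)) = w u * exp (- (x + T u) * s)" for u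
        by (simp add: algebra_simps flip: exp_add)
      have "exp (- x * s) * moment 0 s = (\<integral>u. exp (- x * s) * (w u * exp (- s * T u)) \<partial>M)"
        by (simp add: moment_def)
      also have "\<dots> = (\<integral>u. w u * exp (- (x + T u) * s) \<partial>M)"
        by (simp only: exp_split)
      finally have eq: "exp (- x * s) * moment 0 s = (\<integral>u. w u * exp (- (x + T u) * s) \<partial>M)" .
      have "integrable M (\<lambda>u. exp (- x * s) * (w u * (T u ^ 0 * exp (- s * T u))))"
        using integrable_moment[OF True, of 0] by (rule integrable_mult_right)
      also have "(\<lambda>u. exp (- x * s) * (w u * (T u ^ 0 * exp (- s * T u)))) = (\<lambda>u. w u * exp (- (x + T u) * s))"
        by (simp only: power_0 mult_1 exp_split)
      finally have "(\<integral>\<^sup>+u. ennreal (w u * exp (- (x + T u) * s)) \<partial>M) = ennreal (\<integral>u. w u * exp (- (x + T u) * s) \<partial>M)"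
        using w_nonneg by (intro nn_integral_eq_integral) auto
      thus ?thesis using True eq by simp
    qed simp
  qed
  also have "\<dots> = (\<integral>\<^sup>+u. \<integral>\<^sup>+s. ennreal (indicator {0<..} s * (w u * exp (- (x + T u) * s))) \<partial>lborel \<partial>M)"
    by (rule L.Fubini') measurable
  also have "\<dots> = (\<integral>\<^sup>+u. ennreal (w u / (x + T u)) \<partial>M)"
  proof (intro nn_integral_cong)
    fix u
    have pos: "0 < x + T u" using x T_pos[of u] by simp
    have i0: "((\<lambda>s. exp (- (x + T u) * s)) has_integral 1 / (x + T u)) {0..}"
      using has_integral_exp_minus_to_infinity[OF pos, of 0] by simp
    have "{s \<in> {0..} - {0<..}. exp (- (x + T u) * s) \<noteq> 0} \<subseteq> {0}"
      "{s \<in> {0<..} - {0..}. exp (- (x + T u) * s) \<noteq> 0} \<subseteq> {0}" by auto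
    from has_integral_spike_set_eq[OF this[THEN negligible_subset[OF negligible_sing]]] i0
    have "((\<lambda>s. exp (- (x + T u) * s)) has_integral 1 / (x + T u)) {0<..}"
      by blast
    from nn_integral_has_integral_lebesgue[OF _ this]
    have i1: "(\<integral>\<^sup>+s. ennreal (indicator {0<..} s * exp (- (x + T u) * s)) \<partial>lborel) = ennreal (1 / (x + T u))"
      by simp
    have "(\<integral>\<^sup>+s. ennreal (indicator {0<..} s * (w u * exp (- (x + T u) * s))) \<partial>lborel)
       = (\<integral>\<^sup>+s. ennreal (w u) * ennreal (indicator {0<..} s * exp (- (x + T u) * s)) \<partial>lborel)"
      using w_nonneg[of u] by (intro nn_integral_cong) (simp add: mult_ac flip: ennreal_mult)
    also have "\<dots> = ennreal (w u) * ennreal (1 / (x + T u))"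
      by (subst nn_integral_cmult) (simp_all only: i1, measurable)
    also have "\<dots> = ennreal (w u / (x + T u))"
      using w_nonneg[of u] pos by (simp flip: ennreal_mult)
    finally show "(\<integral>\<^sup>+s. ennreal (indicator {0<..} s * (w u * exp (- (x + T u) * s))) \<partial>lborel) = ennreal (w u / (x + T u))" .
  qed
  also have "\<dots> = ennreal (\<integral>u. w u / (x + T u) \<partial>M)"
  proof (rule nn_integral_eq_integral)
    show "integrable M (\<lambda>u. w u / (x + T u))"
    proof (rule Bochner_Integration.integrable_bound[OF integrable_w_div_T])
      show "AE u in M. norm (w u / (x + T u)) \<le> norm (w u / T u)"
      proof (intro AE_I2)
        fix u
        have "w u / (x + T u) \<le> w u / T u"
          using x T_pos[of u] w_nonneg[of u] by (intro divide_left_mono mult_pos_pos) auto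
        moreover have "0 \<le> w u / (x + T u)" using x T_pos[of u] w_nonneg[of u] by simp
        ultimately show "norm (w u / (x + T u)) \<le> norm (w u / T u)"
          unfolding real_norm_def by linarith
      qed
    qed simp
    show "AE u in M. 0 \<le> w u / (x + T u)"
      using w_nonneg T_pos x by (intro AE_I2 divide_nonneg_nonneg add_nonneg_nonneg) (auto simp: less_imp_le)
  qed
  finally show "(\<integral>\<^sup>+s. ennreal (indicator {0<..} s * (exp (- x * s) * moment 0 s)) \<partial>lborel) = ennreal (\<integral>u. w u / (x + T u) \<partial>M)" .
qed

text \<open>Subtracting the Laplace formula at \<open>x\<close> from the one at \<open>0\<close>
  produces the factor \<open>1 - exp (- x * s)\<close>. The linear coefficient is \<open>0\<close>
  and the completely monotonic density is \<open>moment 0\<close>.\<close>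

lemma complete_Bernstein_function_of_density:
  assumes a: "0 \<le> a"
    and f: "\<And>x. 0 < x \<Longrightarrow> f x = a + (\<integral>u. w u / T u \<partial>M) - (\<integral>u. w u / (x + T u) \<partial>M)"
  shows "complete_Bernstein_function f"
proof -
  have L0: "has_bochner_integral lborel (\<lambda>s. indicator {0<..} s * moment 0 s) (\<integral>u. w u / T u \<partial>M)"
    using has_bochner_integral_exp_moment[of 0] by simp
  have m_nonneg: "0 \<le> moment 0 s" for s
    unfolding moment_def using w_nonneg by (intro integral_nonneg_AE AE_I2 mult_nonneg_nonneg) auto
  have [measurable]: "moment 0 \<in> borel_measurable borel"
    unfolding moment_def[abs_def] by measurable
  have rep: "f x = a + 0 * x + (LBINT s:{0<..}. (1 - exp (- x * s)) * moment 0 s)" if "0 < x" for x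
  proof -
    have "has_bochner_integral lborel (\<lambda>s. indicator {0<..} s * moment 0 s - indicator {0<..} s * (exp (- x * s) * moment 0 s))
       ((\<integral>u. w u / T u \<partial>M) - (\<integral>u. w u / (x + T u) \<partial>M))"
      using that by (intro has_bochner_integral_diff L0 has_bochner_integral_exp_moment) auto
    also have "(\<lambda>s. indicator {0<..} s * moment 0 s - indicator {0<..} s * (exp (- x * s) * moment 0 s))
       = (\<lambda>s. indicator {0<..} s *\<^sub>R ((1 - exp (- x * s)) * moment 0 s))"
      by (simp add: fun_eq_iff algebra_simps)
    finally show ?thesis
      using f[OF that] by (simp add: set_lebesgue_integral_def has_bochner_integral_iff)
  qed
  \<comment> \<open>\<open>moment 0\<close> is already integrable on the half-line, and the factor
    \<open>min 1 s\<close> only makes it smaller.\<close>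
  have "set_integrable lborel {0<..} (\<lambda>s. min 1 s * moment 0 s)"
    unfolding set_integrable_def
  proof (rule Bochner_Integration.integrable_bound)
    show "integrable lborel (\<lambda>s. indicator {0<..} s * moment 0 s)"
      using L0 by (simp add: has_bochner_integral_iff)
    show "AE s in lborel. norm (indicator {0<..} s *\<^sub>R (min 1 s * moment 0 s)) \<le> norm (indicator {0<..} s * moment 0 s)"
      using m_nonneg by (intro AE_I2) (auto simp: indicator_def abs_mult intro!: mult_left_le_one_le)
  qed measurable
  moreover have "0 \<le> f x" if "0 < x" for x
  proof -
    have "0 \<le> (LBINT s:{0<..}. (1 - exp (- x * s)) * moment 0 s)"
      unfolding set_lebesgue_integral_def using m_nonneg that
      by (intro integral_nonneg_AE AE_I2) (auto simp: indicator_def)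
    thus ?thesis using rep[OF that] a by simp
  qed
  ultimately show ?thesis
    unfolding complete_Bernstein_function_def using a completely_monotonic_moment rep
    by (intro conjI allI impI exI[of _ a] exI[of _ 0] exI[of _ "moment 0"]) auto
qed

end

section \<open>The two cases of the theorem\<close>

theorem theorem1:
  fixes r :: real
  assumes "0 < r"
  shows "(r < 1 \<longrightarrow> complete_Bernstein_function (log_quotient r)) \<and>
         (1 < r \<longrightarrow> Stieltjes_function (log_quotient r))"
proof (intro conjI impI)
  assume r: "r < 1"
  define g where "g u = Im (log_affine_exp_quot r (Complex u pi)) / pi" for u
  have [measurable]: "g \<in> borel_measurable borel"
    unfolding g_def[abs_def] using log_affine_exp_quot_boundary_measurable[OF assms r] by measurable
  \<comment> \<open>Representation at \<open>y = 1 + x\<close>. The point \<open>x = 0\<close> is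
    treated apart: \<open>log_quotient r 0\<close> is \<open>0\<close> by the convention for
    division by zero, whereas the holomorphic quotient has the value \<open>r\<close> there.\<close>
  have rep: "has_bochner_integral lborel (\<lambda>u. g u * exp u / (x + (1 + exp u)))
      (1 - (if x = 0 then r else log_quotient r x))" if "0 \<le> x" for x
  proof -
    have "has_bochner_integral lborel (\<lambda>u. Im (log_affine_exp_quot r (Complex u pi)) * (exp u / (exp u + (1 + x))) / pi)
           (pi * (1 - (if 1 + x = 1 then r else ln (1 - r + r * (1 + x)) / ln (1 + x))) / pi)"
      using that by (intro has_bochner_integral_divide log_affine_exp_quot_representation assms r) auto
    moreover have "1 - r + r * (1 + x) = 1 + r * x" by (simp add: algebra_simps)
    moreover have "exp u + (1 + x) = x + (1 + exp u)" for u by simp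
    ultimately show ?thesis by (cases "x = 0") (simp_all add: g_def log_quotient_def mult.commute add.commute)
  qed
  interpret laplace_density lborel "\<lambda>u. g u * exp u" "\<lambda>u. 1 + exp u"
  proof
    show "0 \<le> g u * exp u" for u
      using Im_log_affine_exp_quot_boundary[OF assms r, of u] by (simp add: g_def)
    show "0 < 1 + exp u" for u :: real by (simp add: add_pos_pos)
    show "integrable lborel (\<lambda>u. g u * exp u / (1 + exp u))"
      using rep[of 0] by (simp add: has_bochner_integral_iff)
  qed auto
  show "complete_Bernstein_function (log_quotient r)"
  \<comment> \<open>The integrals at \<open>0\<close> and at \<open>x\<close> equal
    \<open>1 - r\<close> and \<open>1 - log_quotient r x\<close>; their difference gives the
    constant \<open>r\<close>.\<close>
  proof (rule complete_Bernstein_function_of_density[of r])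
    show "log_quotient r x = r + (LBINT u. g u * exp u / (1 + exp u)) - (LBINT u. g u * exp u / (x + (1 + exp u)))"
      if "0 < x" for x
      using rep[of 0] rep[of x] that by (simp add: has_bochner_integral_iff)
  qed (use assms in simp)
next
  assume r: "1 < r"
  \<comment> \<open>With \<open>q = 1 / r\<close> and \<open>y = 1 + r * x\<close> one has
    \<open>1 - q + q * y = 1 + x\<close>, so the holomorphic quotient at \<open>ln y\<close> is the
    reciprocal of \<open>log_quotient r x\<close>.\<close>
  define q where "q = 1 / r"
  have q: "0 < q" "q < 1" using r by (auto simp: q_def)
  define g where "g u = - Im (inverse (log_affine_exp_quot q (Complex u pi))) / pi" for u
  have [measurable]: "g \<in> borel_measurable borel"
    unfolding g_def[abs_def] using log_affine_exp_quot_boundary_measurable[OF q] by measurable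
  show "Stieltjes_function (log_quotient r)"
  \<comment> \<open>\<open>c = 1\<close> is the limit of the reciprocal at the right end of the
    strip; \<open>T\<close> comes from factoring the denominator \<open>exp u + (1 + r * x)\<close>
    as \<open>r * (x + T u)\<close>.\<close>
  proof (rule Stieltjes_function_of_density[where M = lborel and w = "\<lambda>u. g u * exp u / r" and T = "\<lambda>u. (1 + exp u) / r" and c = 1])
    show "0 \<le> g u * exp u / r" for u
      using Im_log_affine_exp_quot_boundary[OF q, of u] assms by (simp add: g_def divide_nonneg_nonneg)
    show "0 \<le> (1 + exp u) / r" for u using assms by (simp add: add_nonneg_nonneg)
    fix x :: real assume x: "0 < x"
    have "has_bochner_integral lborel (\<lambda>u. - Im (inverse (log_affine_exp_quot q (Complex u pi))) * (exp u / (exp u + (1 + r * x))) / pi)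
           (pi * (inverse (if 1 + r * x = 1 then q else ln (1 - q + q * (1 + r * x)) / ln (1 + r * x)) - 1) / pi)"
      using x assms by (intro has_bochner_integral_divide inverse_log_affine_exp_quot_representation q) (auto intro: add_pos_pos)
    moreover have "1 - q + q * (1 + r * x) = 1 + x" using assms by (simp add: q_def field_simps)
    moreover have "g u * exp u / r / (x + (1 + exp u) / r) =
       - Im (inverse (log_affine_exp_quot q (Complex u pi))) * (exp u / (exp u + (1 + r * x))) / pi" for u
    proof -
      have "0 < exp u + (1 + r * x)" using x assms by (simp add: add_pos_pos)
      moreover have "x + (1 + exp u) / r = (exp u + (1 + r * x)) / r" using assms by (simp add: field_simps)
      ultimately show ?thesis using assms by (simp add: g_def)
    qed
    ultimately show "has_bochner_integral lborel (\<lambda>u. g u * exp u / r / (x + (1 + exp u) / r)) (log_quotient r x - 1)"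
      using x assms by (simp add: log_quotient_def)
  qed auto
qed

end
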